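(* Let $M^m$ be an oriented submanifold of $\mathbb{R}^n$ with induced metric $g$, canonical inclusion $\mathbf{i}:M\to\mathbb{R}^n$ and Gauss map $G:M\to G(n,m)$. Assume that $m>2$. Then any two of the following statements imply the third: (a) $S_2^{\mathbf{i}}=fg$, where $f\in C^\infty(M)$; (b) $M$ is Einstein; (c) $G$ is weakly conformal.
   Context: All manifolds and maps are smooth. For a map $\phi:(M^m,g)\to(N,h)$ between Riemannian manifolds, $\nabla$ denotes the connection on $\phi^{-1}TN$ induced by the Levi-Civita connection of $N$ (and also induced connections on related bundles), and $\tau(\phi)=\operatorname{trace}_g\nabla d\phi$ is the tension field. With $\{e_i\}$ a local $g$-orthonormal frame, put $\langle d\phi,\nabla\tau(\phi)\rangle=\sum_i\langle d\phi(e_i),\nabla_{e_i}\tau(\phi)\rangle$. The biharmonic stress-energy tensor of $\phi$ is the symmetric $(0,2)$-tensor $$S_2^{\phi}(X,Y)=\Big(\tfrac12|\tau(\phi)|^2+\langle d\phi,\nabla\tau(\phi)\rangle\Big)g(X,Y)-\langle d\phi(X),\nabla_Y\tau(\phi)\rangle-\langle d\phi(Y),\nabla_X\tau(\phi)\rangle .$$ For an oriented submanifold $M^m\subset\mathbb{R}^n$ with induced metric $g$, the Gauss map $G:M\to G(n,m)$ sends $q$ to the oriented $m$-plane $T_qM$, i.e. $G(q)=X_1(q)\wedge\dots\wedge X_m(q)$ for a positively oriented orthonormal basis of $T_qM$; $G(n,m)$ is the Grassmannian of oriented $m$-planes of $\mathbb{R}^n$ with its canonical metric $g_{can}$: for a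 plane $P$ with orthonormal basis $X_1,\dots,X_m$ completed to an orthonormal basis $X_1,\dots,X_n$ of $\mathbb{R}^n$, identify $T_PG(n,m)$ with $P^*\otimes P^\perp$ and require $\{X_j^*\otimes X_a: 1\le j\le m<a\le n\}$ to be an orthonormal basis. A map $\phi:(M,g)\to(N,h)$ is weakly conformal if $\phi^*h=\lambda g$ for some function $\lambda\ge0$ on $M$ (zeros allowed). $M$ is Einstein if its Ricci tensor is proportional to the metric, $\mathrm{Ricci}=cg$ (for $m>2$ the factor $c$ is then automatically constant on each connected component of $M$). *)

theory Defs
  imports "HOL-Analysis.Analysis"
begin

section \<open>Smooth functions on open sets\<close>

text \<open>Meaningful for open \<open>S\<close> only, since it uses the Frechet derivative at interior points.\<close>

primrec Ck_on :: "nat \<Rightarrow> 'a::euclidean_space set \<Rightarrow> ('a \<Rightarrow> 'b::real_normed_vector) \<Rightarrow> bool" where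
  "Ck_on 0 S f \<longleftrightarrow> continuous_on S f"
| "Ck_on (Suc k) S f \<longleftrightarrow> (\<forall>x\<in>S. f differentiable (at x)) \<and>
     (\<forall>v. Ck_on k S (\<lambda>x. frechet_derivative f (at x) v))"

definition smooth_on :: "'a::euclidean_space set \<Rightarrow> ('a \<Rightarrow> 'b::real_normed_vector) \<Rightarrow> bool" where
  "smooth_on S f \<longleftrightarrow> (\<forall>k. Ck_on k S f)"

definition pd :: "'m::finite \<Rightarrow> (real^'m \<Rightarrow> 'b::real_normed_vector) \<Rightarrow> real^'m \<Rightarrow> 'b" where
  "pd i f u = frechet_derivative f (at u) (axis i 1)"


section \<open>Oriented submanifolds of Euclidean space\<close>

text \<open>
  A local parametrization is a pair \<open>(U, \<phi>)\<close> of an open set of \<open>real^'m\<close> and an injective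
  immersion \<open>\<phi>\<close> of \<open>U\<close>.  The manifold structure and the orientation of \<open>M\<close> are given by a
  positively oriented atlas \<open>A\<close> of such parametrizations, whose transition maps have positive
  Jacobian determinant; positively oriented bases of tangent spaces are those oriented like the
  coordinate frames.  The topology of \<open>M\<close> is the one defined by \<open>A\<close>; it may be finer than the
  subspace topology, so that \<open>M\<close> is a submanifold in the general sense (the inclusion is an
  injective immersion), embedded submanifolds being a special case.  The Hausdorff property is
  automatic, because the inclusion is continuous and injective.
\<close>

type_synonym ('m, 'n) param = "(real^'m) set \<times> (real^'m \<Rightarrow> real^'n)"

definition local_param :: "('m::finite, 'n::finite) param \<Rightarrow> bool" where
  "local_param c \<longleftrightarrow> (case c of (U, \<phi>) \<Rightarrow>
     open U \<and> smooth_on U \<phi> \<and> inj_on \<phi> U \<and> (\<forall>u\<in>U. inj (frechet_derivative \<phi> (at u))))"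

definition overlap :: "('m::finite, 'n::finite) param \<Rightarrow> ('m, 'n) param \<Rightarrow> (real^'m) set" where
  "overlap c d = {u \<in> fst c. snd c u \<in> snd d ` fst d}"

definition transition ::
  "('m::finite, 'n::finite) param \<Rightarrow> ('m, 'n) param \<Rightarrow> real^'m \<Rightarrow> real^'m" where
  "transition c d = (\<lambda>u. inv_into (fst d) (snd d) (snd c u))"

definition oriented_submanifold ::
  "(real^'n::finite) set \<Rightarrow> ('m::finite, 'n) param set \<Rightarrow> bool" where
  "oriented_submanifold M A \<longleftrightarrow>
     (\<forall>c\<in>A. local_param c) \<and>
     M = (\<Union>(U, \<phi>)\<in>A. \<phi> ` U) \<and>
     (\<exists>B\<subseteq>A. countable B \<and> M = (\<Union>(U, \<phi>)\<in>B. \<phi> ` U)) \<and>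
     (\<forall>c\<in>A. \<forall>d\<in>A. open (overlap c d) \<and> smooth_on (overlap c d) (transition c d) \<and>
        (\<forall>u\<in>overlap c d. det (matrix (frechet_derivative (transition c d) (at u))) > 0))"

definition smooth_function ::
  "('m::finite, 'n::finite) param set \<Rightarrow> (real^'n \<Rightarrow> real) \<Rightarrow> bool" where
  "smooth_function A f \<longleftrightarrow> (\<forall>(U, \<phi>)\<in>A. smooth_on U (f \<circ> \<phi>))"


section \<open>Riemannian geometry in local coordinates\<close>

text \<open>
  Tensor fields are given by their components with respect to the coordinate frame of a local
  parametrization; an identity between tensor fields on \<open>M\<close> is the identity of the components in
  every parametrization of the atlas.
\<close>

definition induced_metric :: "(real^'m::finite \<Rightarrow> real^'n::finite) \<Rightarrow> real^'m \<Rightarrow> real^'m^'m" where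
  "induced_metric \<phi> u = (\<chi> i j. pd i \<phi> u \<bullet> pd j \<phi> u)"

text \<open>\<open>christoffel g u k i j\<close> is \<open>\<Gamma>\<^sup>k\<^sub>i\<^sub>j\<close>, the Levi-Civita connection of \<open>g\<close> in coordinates.\<close>

definition christoffel ::
  "(real^'m::finite \<Rightarrow> real^'m^'m) \<Rightarrow> real^'m \<Rightarrow> 'm \<Rightarrow> 'm \<Rightarrow> 'm \<Rightarrow> real" where
  "christoffel g u k i j =
     1/2 * (\<Sum>l\<in>UNIV. matrix_inv (g u) $ k $ l *
       (pd i (\<lambda>w. g w $ j $ l) u + pd j (\<lambda>w. g w $ i $ l) u - pd l (\<lambda>w. g w $ i $ j) u))"

text \<open>
  \<open>riemann g u l i j k\<close> is the \<open>l\<close>-th component of \<open>R(\<partial>\<^sub>i, \<partial>\<^sub>j) \<partial>\<^sub>k\<close>, where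
  \<open>R(X, Y) Z = \<nabla>\<^sub>X \<nabla>\<^sub>Y Z - \<nabla>\<^sub>Y \<nabla>\<^sub>X Z - \<nabla>\<^bsub>[X, Y]\<^esub> Z\<close>, and \<open>Ricci(Y, Z)\<close> is the trace of
  \<open>X \<mapsto> R(X, Y) Z\<close>.
\<close>

definition riemann ::
  "(real^'m::finite \<Rightarrow> real^'m^'m) \<Rightarrow> real^'m \<Rightarrow> 'm \<Rightarrow> 'm \<Rightarrow> 'm \<Rightarrow> 'm \<Rightarrow> real" where
  "riemann g u l i j k =
     pd i (\<lambda>w. christoffel g w l j k) u - pd j (\<lambda>w. christoffel g w l i k) u +
     (\<Sum>p\<in>UNIV. christoffel g u l i p * christoffel g u p j k -
              christoffel g u l j p * christoffel g u p i k)"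

definition ricci :: "(real^'m::finite \<Rightarrow> real^'m^'m) \<Rightarrow> real^'m \<Rightarrow> real^'m^'m" where
  "ricci g u = (\<chi> j k. \<Sum>i\<in>UNIV. riemann g u i i j k)"

definition einstein :: "('m::finite, 'n::finite) param set \<Rightarrow> bool" where
  "einstein A \<longleftrightarrow> (\<exists>c :: real^'n \<Rightarrow> real. \<forall>(U, \<phi>)\<in>A. \<forall>u\<in>U.
     ricci (induced_metric \<phi>) u = c (\<phi> u) *\<^sub>R induced_metric \<phi> u)"


section \<open>Tension field and biharmonic stress-energy tensor\<close>

text \<open>
  Here \<open>F\<close> is the coordinate expression of a map from a Riemannian manifold with metric \<open>g\<close> into a
  Euclidean space.  As the target is flat, the induced connection on the pull-back of its tangent
  bundle differentiates vector-valued functions componentwise.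
\<close>

definition hessian_map ::
  "(real^'m::finite \<Rightarrow> real^'m^'m) \<Rightarrow> (real^'m \<Rightarrow> real^'k::finite) \<Rightarrow> real^'m \<Rightarrow> 'm \<Rightarrow> 'm \<Rightarrow> real^'k" where
  "hessian_map g F u i j = pd i (pd j F) u - (\<Sum>k\<in>UNIV. christoffel g u k i j *\<^sub>R pd k F u)"

definition tension ::
  "(real^'m::finite \<Rightarrow> real^'m^'m) \<Rightarrow> (real^'m \<Rightarrow> real^'k::finite) \<Rightarrow> real^'m \<Rightarrow> real^'k" where
  "tension g F u =
     (\<Sum>i\<in>UNIV. \<Sum>j\<in>UNIV. matrix_inv (g u) $ i $ j *\<^sub>R hessian_map g F u i j)"

definition dphi_nabla_tension ::
  "(real^'m::finite \<Rightarrow> real^'m^'m) \<Rightarrow> (real^'m \<Rightarrow> real^'k::finite) \<Rightarrow> real^'m \<Rightarrow> real" where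
  "dphi_nabla_tension g F u =
     (\<Sum>i\<in>UNIV. \<Sum>j\<in>UNIV. matrix_inv (g u) $ i $ j * (pd i F u \<bullet> pd j (tension g F) u))"

definition stress_energy2 ::
  "(real^'m::finite \<Rightarrow> real^'m^'m) \<Rightarrow> (real^'m \<Rightarrow> real^'k::finite) \<Rightarrow> real^'m \<Rightarrow> real^'m^'m" where
  "stress_energy2 g F u = (\<chi> i j.
     (1/2 * (norm (tension g F u))\<^sup>2 + dphi_nabla_tension g F u) * g u $ i $ j
     - pd i F u \<bullet> pd j (tension g F) u - pd j F u \<bullet> pd i (tension g F) u)"


section \<open>The Grassmannian of oriented planes\<close>

text \<open>
  An ordered family \<open>X\<^sub>1, ..., X\<^sub>m\<close> of vectors of \<open>real^'n\<close> is the matrix with these rows.  The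
  oriented plane \<open>oplane X\<close>, corresponding to \<open>X\<^sub>1 \<and> ... \<and> X\<^sub>m\<close>, is represented by the set of all its
  positively oriented orthonormal bases.  The Grassmannian of oriented \<open>m\<close>-planes is the set of all
  \<open>oplane X\<close> with \<open>X\<close> orthonormal.
\<close>

definition orthonormal_frame :: "real^'n::finite^'m::finite \<Rightarrow> bool" where
  "orthonormal_frame X \<longleftrightarrow> (\<forall>i j. X $ i \<bullet> X $ j = (if i = j then 1 else 0))"

definition same_orientation :: "real^'n::finite^'m::finite \<Rightarrow> real^'n^'m \<Rightarrow> bool" where
  "same_orientation X Y \<longleftrightarrow> (\<exists>L :: real^'m^'m. det L > 0 \<and> X = L ** Y)"

definition oplane :: "real^'n::finite^'m::finite \<Rightarrow> (real^'n^'m) set" where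
  "oplane Y = {X. orthonormal_frame X \<and> same_orientation X Y}"

definition plane_of :: "(real^'n::finite^'m::finite) set \<Rightarrow> (real^'n) set" where
  "plane_of P = (\<Union>X\<in>P. span (rows X))"

text \<open>
  \<open>grass_tangent P\<close> is the tangent space \<open>P\<^sup>* \<otimes> P\<^sup>\<bottom>\<close> at \<open>P\<close>, that is, the space of linear maps from \<open>P\<close> to
  its orthogonal complement, extended by zero to \<open>real^'n\<close>.
\<close>

definition grass_tangent :: "(real^'n::finite^'m::finite) set \<Rightarrow> (real^'n^'n) set" where
  "grass_tangent P = {T. (\<forall>x\<in>plane_of P. T *v x \<in> orthogonal_comp (plane_of P)) \<and>
                         (\<forall>y\<in>orthogonal_comp (plane_of P). T *v y = 0)}"

text \<open>
  Since \<open>S (X\<^sub>j) \<bullet> a\<close> is the coefficient of \<open>S\<close> at \<open>X\<^sub>j\<^sup>* \<otimes> a\<close>, this is the inner product for which the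
  \<open>X\<^sub>j\<^sup>* \<otimes> a\<close> form an orthonormal basis; it does not depend on the choice of the bases.
\<close>

definition grass_metric ::
  "(real^'n::finite^'m::finite) set \<Rightarrow> real^'n^'n \<Rightarrow> real^'n^'n \<Rightarrow> real" where
  "grass_metric P S T =
     (let X = (SOME X. X \<in> P);
          N = (SOME N. pairwise orthogonal N \<and> (\<forall>a\<in>N. norm a = 1) \<and>
                       span N = orthogonal_comp (plane_of P))
      in \<Sum>j\<in>UNIV. \<Sum>a\<in>N. ((S *v (X $ j)) \<bullet> a) * ((T *v (X $ j)) \<bullet> a))"

text \<open>
  The chart of the Grassmannian centred at \<open>P\<close>: oriented planes \<open>Q\<close> near \<open>P\<close> are the graphs of the
  linear maps \<open>T\<close> from \<open>P\<close> to its orthogonal complement, oriented by \<open>X\<^sub>1 + T X\<^sub>1, ..., X\<^sub>m + T X\<^sub>m\<close>.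
  The identification of the tangent space at \<open>P\<close> with \<open>P\<^sup>* \<otimes> P\<^sup>\<bottom>\<close> is the differential of this chart at \<open>P\<close>:
  the velocity of a curve \<open>X\<^sub>1(t) \<and> ... \<and> X\<^sub>m(t)\<close> through \<open>P\<close> is the map taking \<open>X\<^sub>j\<close> to the
  component of \<open>X\<^sub>j'\<close> orthogonal to \<open>P\<close>.
\<close>

definition grass_chart ::
  "(real^'n::finite^'m::finite) set \<Rightarrow> (real^'n^'m) set \<Rightarrow> real^'n^'n" where
  "grass_chart P Q = (THE T. T \<in> grass_tangent P \<and>
     (\<forall>X\<in>P. Q = oplane (\<chi> j. X $ j + T *v (X $ j))))"

definition grass_differential ::
  "(real^'d::finite \<Rightarrow> (real^'n::finite^'m::finite) set) \<Rightarrow> real^'d \<Rightarrow> real^'d \<Rightarrow> real^'n^'n" where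
  "grass_differential H u v = frechet_derivative (\<lambda>w. grass_chart (H u) (H w)) (at u) v"


section \<open>Gauss map and weak conformality\<close>

definition pos_orthonormal_basis ::
  "('m::finite, 'n::finite) param set \<Rightarrow> real^'n \<Rightarrow> real^'n^'m \<Rightarrow> bool" where
  "pos_orthonormal_basis A q X \<longleftrightarrow> orthonormal_frame X \<and>
     (\<exists>(U, \<phi>)\<in>A. \<exists>u\<in>U. \<phi> u = q \<and> same_orientation X (\<chi> i. pd i \<phi> u))"

definition gauss_map ::
  "('m::finite, 'n::finite) param set \<Rightarrow> real^'n \<Rightarrow> (real^'n^'m) set" where
  "gauss_map A q = oplane (SOME X. pos_orthonormal_basis A q X)"

text \<open>Weak conformality of a map from \<open>M\<close> with the induced metric to the Grassmannian.\<close>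

definition weakly_conformal ::
  "(real^'n::finite) set \<Rightarrow> ('m::finite, 'n) param set \<Rightarrow> (real^'n \<Rightarrow> (real^'n^'m) set) \<Rightarrow> bool" where
  "weakly_conformal M A G \<longleftrightarrow>
     (\<exists>\<mu> :: real^'n \<Rightarrow> real. (\<forall>q\<in>M. \<mu> q \<ge> 0) \<and>
       (\<forall>(U, \<phi>)\<in>A. \<forall>u\<in>U. \<forall>i j.
          grass_metric (G (\<phi> u)) (grass_differential (G \<circ> \<phi>) u (axis i 1))
                                 (grass_differential (G \<circ> \<phi>) u (axis j 1))
          = \<mu> (\<phi> u) * induced_metric \<phi> u $ i $ j))"

end

theory Submission
  imports Defs
begin

text \<open>
  Let \<open>B\<close> be the second fundamental form of \<open>M\<close>, \<open>\<tau>\<close> its trace, which is the tension field of the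
  inclusion, and \<open>T(X, Y) = \<Sum>\<^sub>k \<langle>B(X, e\<^sub>k), B(Y, e\<^sub>k)\<rangle>\<close> for an orthonormal basis \<open>e\<^sub>k\<close> of the tangent
  space.  The three tensors in the theorem are combinations of \<open>g\<close>, \<open>\<langle>B, \<tau>\<rangle>\<close> and \<open>T\<close>:

  \<^item> \<open>S\<^sub>2 = 2 \<langle>B, \<tau>\<rangle> - 1/2 |\<tau>|\<^sup>2 g\<close>, because \<open>\<tau>\<close> is normal and hence \<open>\<langle>X, \<nabla>\<^sub>Y \<tau>\<rangle> = - \<langle>B(X, Y), \<tau>\<rangle>\<close>
    (\<open>stress_energy2_eq\<close>);
  \<^item> \<open>Ricci = \<langle>B, \<tau>\<rangle> - T\<close>, the contracted Gauss equation (\<open>ricci_eq\<close>);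
  \<^item> \<open>G\<^sup>* g\<^sub>c\<^sub>a\<^sub>n = T\<close>, because \<open>dG(X)\<close> is the linear map \<open>Y \<mapsto> B(X, Y)\<close>
    (\<open>grass_metric_gauss_differential\<close>).

  So (a), (b) and (c) say that \<open>\<langle>B, \<tau>\<rangle>\<close>, \<open>\<langle>B, \<tau>\<rangle> - T\<close> and \<open>T\<close>, respectively, are pointwise multiples of
  \<open>g\<close>, and any two of these give the third by adding or subtracting.  The sign condition in (c) holds since \<open>T\<close>
  is positive semidefinite.  The smoothness required in (a) comes from taking the trace of
  \<open>\<langle>B, \<tau>\<rangle> = s g\<close>, which gives \<open>s = |\<tau>|\<^sup>2 / m\<close>.

  The factors have to be functions on \<open>M\<close>, whereas all tensors are computed in charts.  In passing
  between (a) and \<open>\<langle>B, \<tau>\<rangle> = s g\<close> the function \<open>|\<tau>|\<^sup>2\<close> enters, so it must be seen not to depend on the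
  chart (taking traces in (a) would determine it from \<open>f\<close> only if \<open>m \<noteq> 4\<close>).  As \<open>B\<close> is the differential
  of \<open>G\<close>, which is a function on \<open>M\<close>, the chain rule for \<open>G\<close> in two charts is enough
  (\<open>tension_well_defined\<close>), and second derivatives of transition maps never appear.

  Two analytic ingredients are developed on the way: the closure of smooth functions under the
  algebraic operations used in Riemannian geometry, including matrix inversion, and the symmetry of
  second derivatives.
\<close>

section \<open>Calculus of smooth functions\<close>

lemma frechet_derivative_eqI: "(f has_derivative f') (at x) \<Longrightarrow> frechet_derivative f (at x) = f'"
  using frechet_derivative_at by metis

lemma has_derivative_frechet:
  "f differentiable (at x) \<Longrightarrow> (f has_derivative frechet_derivative f (at x)) (at x)"
  using frechet_derivative_works by blast

text \<open>At a point where one function has no derivative the other has none either, and both sides are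
  the same default value.\<close>

lemma frechet_derivative_cong_on_open:
  assumes "open S" "x \<in> S" "\<And>y. y \<in> S \<Longrightarrow> f y = g y"
  shows "frechet_derivative f (at x) = frechet_derivative g (at x)"
proof -
  have "(f has_derivative D) (at x) \<longleftrightarrow> (g has_derivative D) (at x)" for D
    using assms has_derivative_transform_within_open by (metis (full_types))
  then show ?thesis
    by (simp add: frechet_derivative_def)
qed

lemma Ck_on_cong:
  assumes "open S" "\<And>y. y \<in> S \<Longrightarrow> f y = g y" "Ck_on k S f"
  shows "Ck_on k S g"
  using assms(2,3)
proof (induction k arbitrary: f g)
  case 0
  then show ?case by (simp cong: continuous_on_cong)
next
  case (Suc k)
  have "g differentiable (at x)" if "x \<in> S" for x
    using Suc.prems that assms(1) has_derivative_transform_within_open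
    unfolding differentiable_def by (metis Ck_on.simps(2) differentiable_def)
  moreover have "Ck_on k S (\<lambda>x. frechet_derivative g (at x) v)" for v
  proof (rule Suc.IH)
    show "Ck_on k S (\<lambda>x. frechet_derivative f (at x) v)"
      using Suc.prems by simp
    show "frechet_derivative f (at y) v = frechet_derivative g (at y) v" if "y \<in> S" for y
      using frechet_derivative_cong_on_open[OF assms(1) that, of f g] Suc.prems(1) by simp
  qed
  ultimately show ?case by simp
qed

lemma Ck_on_Suc_imp: "Ck_on (Suc k) S f \<Longrightarrow> Ck_on k S f"
proof (induction k arbitrary: f)
  case 0
  then show ?case
    by (auto intro!: continuous_at_imp_continuous_on differentiable_imp_continuous_within)
next
  case (Suc k)
  then show ?case by simp
qed

lemma Ck_on_const: "Ck_on k S (\<lambda>x. c)"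
  by (induction k arbitrary: c) auto

lemma Ck_on_add:
  assumes "open S" "Ck_on k S f" "Ck_on k S g"
  shows "Ck_on k S (\<lambda>x. f x + g x)"
  using assms(2,3)
proof (induction k arbitrary: f g)
  case 0
  then show ?case by (auto intro: continuous_intros)
next
  case (Suc k)
  have "Ck_on k S (\<lambda>x. frechet_derivative (\<lambda>x. f x + g x) (at x) v)" for v
  proof (rule Ck_on_cong[OF assms(1)])
    show "Ck_on k S (\<lambda>x. frechet_derivative f (at x) v + frechet_derivative g (at x) v)"
      using Suc by simp
    show "frechet_derivative f (at y) v + frechet_derivative g (at y) v =
        frechet_derivative (\<lambda>x. f x + g x) (at y) v" if "y \<in> S" for y
      using has_derivative_add[OF has_derivative_frechet has_derivative_frechet, of f y g] Suc.prems that
      by (simp add: frechet_derivative_eqI)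
  qed
  then show ?case using Suc.prems by simp
qed

lemma (in bounded_linear) Ck_on:
  fixes g :: "'c::euclidean_space \<Rightarrow> 'a"
  assumes "open S" "Ck_on k S g"
  shows "Ck_on k S (\<lambda>x. f (g x))"
  using assms(2)
proof (induction k arbitrary: g)
  case 0
  then show ?case by (auto intro: continuous_on)
next
  case (Suc k)
  have d: "((\<lambda>x. f (g x)) has_derivative (\<lambda>v. f (frechet_derivative g (at y) v))) (at y)" if "y \<in> S" for y
    using has_derivative[OF has_derivative_frechet, of g y] Suc.prems that by simp
  have "Ck_on k S (\<lambda>x. frechet_derivative (\<lambda>x. f (g x)) (at x) v)" for v
  proof (rule Ck_on_cong[OF assms(1)])
    show "Ck_on k S (\<lambda>x. f (frechet_derivative g (at x) v))"
      using Suc by simp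
    show "f (frechet_derivative g (at y) v) = frechet_derivative (\<lambda>x. f (g x)) (at y) v" if "y \<in> S" for y
      using d[OF that] by (simp add: frechet_derivative_eqI)
  qed
  then show ?case using d by (auto simp: differentiable_def)
qed

text \<open>In the product rule each term pairs the derivative of one factor with the other factor itself,
  and both are of class \<open>C\<^sup>k\<close> if the factors are of class \<open>C\<^sup>k\<^sup>+\<^sup>1\<close>.\<close>

lemma (in bounded_bilinear) Ck_on:
  fixes f :: "'d::euclidean_space \<Rightarrow> 'a"
  assumes "open S" "Ck_on k S f" "Ck_on k S g"
  shows "Ck_on k S (\<lambda>x. f x ** g x)"
  using assms(2,3)
proof (induction k arbitrary: f g)
  case 0
  then show ?case by (auto intro: continuous_on)
next
  case (Suc k)
  have d: "((\<lambda>x. f x ** g x) has_derivative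
      (\<lambda>v. f y ** frechet_derivative g (at y) v + frechet_derivative f (at y) v ** g y)) (at y)"
    if "y \<in> S" for y
    using FDERIV[OF has_derivative_frechet has_derivative_frechet, of f y g] Suc.prems that by simp
  have low: "Ck_on k S f" "Ck_on k S g"
    using Suc.prems by (auto intro!: Ck_on_Suc_imp simp del: Ck_on.simps)
  have "Ck_on k S (\<lambda>x. frechet_derivative (\<lambda>x. f x ** g x) (at x) v)" for v
  proof (rule Ck_on_cong[OF assms(1)])
    show "Ck_on k S (\<lambda>y. f y ** frechet_derivative g (at y) v + frechet_derivative f (at y) v ** g y)"
      using Suc.IH Suc.prems low by (intro Ck_on_add assms(1)) auto
    show "f y ** frechet_derivative g (at y) v + frechet_derivative f (at y) v ** g y
        = frechet_derivative (\<lambda>x. f x ** g x) (at y) v" if "y \<in> S" for y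
      using d[OF that] by (simp add: frechet_derivative_eqI)
  qed
  then show ?case using d by (auto simp: differentiable_def)
qed

lemma Ck_on_inverse:
  fixes f :: "'a::euclidean_space \<Rightarrow> real"
  assumes "open S" "Ck_on k S f" "\<And>x. x \<in> S \<Longrightarrow> f x \<noteq> 0"
  shows "Ck_on k S (\<lambda>x. inverse (f x))"
  using assms(2)
proof (induction k)
  case 0
  then show ?case using assms(3) by (auto intro: continuous_on_inverse)
next
  case (Suc k)
  have d: "((\<lambda>x. inverse (f x)) has_derivative
      (\<lambda>v. - (inverse (f y) * frechet_derivative f (at y) v * inverse (f y)))) (at y)"
    if "y \<in> S" for y
    using Deriv.has_derivative_inverse[OF _ has_derivative_frechet, of f y] assms(3) Suc.prems that by simp
  have "Ck_on k S (\<lambda>x. frechet_derivative (\<lambda>x. inverse (f x)) (at x) v)" for v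
  proof (rule Ck_on_cong[OF assms(1)])
    show "Ck_on k S (\<lambda>y. - (inverse (f y) * frechet_derivative f (at y) v * inverse (f y)))"
      using Suc.IH[OF Ck_on_Suc_imp[OF Suc.prems]] Suc.prems
      by (intro bounded_linear.Ck_on[OF bounded_linear_minus[OF bounded_linear_ident]]
          bounded_bilinear.Ck_on[OF bounded_bilinear_mult] assms(1)) auto
    show "- (inverse (f y) * frechet_derivative f (at y) v * inverse (f y))
        = frechet_derivative (\<lambda>x. inverse (f x)) (at y) v" if "y \<in> S" for y
      using d[OF that] by (simp add: frechet_derivative_eqI)
  qed
  then show ?case using d by (auto simp: differentiable_def)
qed

lemma smooth_on_cong:
  "open S \<Longrightarrow> smooth_on S f \<Longrightarrow> (\<And>y. y \<in> S \<Longrightarrow> f y = g y) \<Longrightarrow> smooth_on S g"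
  unfolding smooth_on_def using Ck_on_cong by metis

lemma smooth_on_const: "smooth_on S (\<lambda>x. c)"
  by (simp add: smooth_on_def Ck_on_const)

lemma smooth_on_add:
  "open S \<Longrightarrow> smooth_on S f \<Longrightarrow> smooth_on S g \<Longrightarrow> smooth_on S (\<lambda>x. f x + g x)"
  by (simp add: smooth_on_def Ck_on_add)

lemma smooth_on_bounded_linear:
  "bounded_linear h \<Longrightarrow> open S \<Longrightarrow> smooth_on S f \<Longrightarrow> smooth_on S (\<lambda>x. h (f x))"
  by (simp add: smooth_on_def bounded_linear.Ck_on)

lemma smooth_on_bounded_bilinear:
  "bounded_bilinear h \<Longrightarrow> open S \<Longrightarrow> smooth_on S f \<Longrightarrow> smooth_on S g \<Longrightarrow> smooth_on S (\<lambda>x. h (f x) (g x))"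
  by (simp add: smooth_on_def bounded_bilinear.Ck_on)

lemmas smooth_on_mult = smooth_on_bounded_bilinear[OF bounded_bilinear_mult]
lemmas smooth_on_scaleR = smooth_on_bounded_bilinear[OF bounded_bilinear_scaleR]
lemmas smooth_on_inner = smooth_on_bounded_bilinear[OF bounded_bilinear_inner]

lemma smooth_on_inverse:
  fixes f :: "'a::euclidean_space \<Rightarrow> real"
  shows "open S \<Longrightarrow> smooth_on S f \<Longrightarrow> (\<And>x. x \<in> S \<Longrightarrow> f x \<noteq> 0) \<Longrightarrow> smooth_on S (\<lambda>x. inverse (f x))"
  by (simp add: smooth_on_def Ck_on_inverse)

lemma smooth_on_diff:
  "open S \<Longrightarrow> smooth_on S f \<Longrightarrow> smooth_on S g \<Longrightarrow> smooth_on S (\<lambda>x. f x - g x)"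
  using smooth_on_add[of S f "\<lambda>x. - g x"]
    smooth_on_bounded_linear[OF bounded_linear_minus[OF bounded_linear_ident], of S g] by simp

lemma smooth_on_sum:
  "open S \<Longrightarrow> (\<And>i. i \<in> I \<Longrightarrow> smooth_on S (f i)) \<Longrightarrow> smooth_on S (\<lambda>x. \<Sum>i\<in>I. f i x)"
  by (induction I rule: infinite_finite_induct) (auto intro: smooth_on_const smooth_on_add)

lemma smooth_on_prod:
  fixes f :: "'i \<Rightarrow> 'a::euclidean_space \<Rightarrow> real"
  shows "open S \<Longrightarrow> (\<And>i. i \<in> I \<Longrightarrow> smooth_on S (f i)) \<Longrightarrow> smooth_on S (\<lambda>x. \<Prod>i\<in>I. f i x)"
  by (induction I rule: infinite_finite_induct) (auto intro: smooth_on_const smooth_on_mult)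

lemma smooth_on_imp_differentiable: "smooth_on S f \<Longrightarrow> x \<in> S \<Longrightarrow> f differentiable (at x)"
  unfolding smooth_on_def using Ck_on.simps(2) by blast

lemma smooth_on_imp_continuous_on: "smooth_on S f \<Longrightarrow> continuous_on S f"
  unfolding smooth_on_def using Ck_on.simps(1) by blast

lemma smooth_on_frechet: "smooth_on S f \<Longrightarrow> smooth_on S (\<lambda>x. frechet_derivative f (at x) v)"
  unfolding smooth_on_def using Ck_on.simps(2) by blast

lemma smooth_on_pd: "smooth_on S f \<Longrightarrow> smooth_on S (pd i f)"
  using smooth_on_frechet[of S f "axis i 1"] by (simp add: pd_def[abs_def])

lemma smooth_on_det:
  fixes A :: "'a::euclidean_space \<Rightarrow> real^'n::finite^'n"
  assumes "open S" "\<And>i j. smooth_on S (\<lambda>x. A x $ i $ j)"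
  shows "smooth_on S (\<lambda>x. det (A x))"
  unfolding det_def
  by (intro smooth_on_sum smooth_on_mult smooth_on_const smooth_on_prod assms)

lemma invertible_right_inverse_inv:
  fixes A :: "real^'n::finite^'n"
  assumes "det A \<noteq> 0"
  shows "A ** matrix_inv A = mat 1" "matrix_inv A ** A = mat 1"
proof -
  have "\<exists>A'. A ** A' = mat 1 \<and> A' ** A = mat 1"
    using assms invertible_det_nz[of A] by (simp add: invertible_def)
  from someI_ex[OF this] show "A ** matrix_inv A = mat 1" "matrix_inv A ** A = mat 1"
    unfolding matrix_inv_def by auto
qed

text \<open>Cramer's rule exhibits the entries of the inverse as rational functions of the entries of the
  matrix; it reduces smoothness of the inverse to that of determinants.\<close>

lemma matrix_inv_cramer:
  fixes A :: "real^'n::finite^'n"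
  assumes "det A \<noteq> 0"
  shows "matrix_inv A $ k $ j = det (\<chi> i l. if l = k then (if i = j then 1 else 0) else A$i$l) * inverse (det A)"
proof -
  have "A *v (\<chi> k. matrix_inv A $ k $ j) = (\<chi> i. if i = j then 1 else 0)"
    using invertible_right_inverse_inv(1)[OF assms]
    by (simp add: vec_eq_iff matrix_vector_mult_def matrix_matrix_mult_def mat_def)
  then have "(\<chi> k. matrix_inv A $ k $ j) =
     (\<chi> k. det (\<chi> i l. if l = k then (if i = j then 1 else 0) else A$i$l) / det A)"
    using cramer[OF assms] by (simp only: vec_lambda_beta)
  then show ?thesis
    by (simp add: vec_eq_iff divide_inverse cong: if_cong)
qed

lemma smooth_on_matrix_inv:
  fixes A :: "'a::euclidean_space \<Rightarrow> real^'n::finite^'n"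
  assumes "open S" "\<And>i j. smooth_on S (\<lambda>x. A x $ i $ j)" "\<And>x. x \<in> S \<Longrightarrow> det (A x) \<noteq> 0"
  shows "smooth_on S (\<lambda>x. matrix_inv (A x) $ k $ j)"
proof -
  have "smooth_on S (\<lambda>x. det (\<chi> i l. if l = k then (if i = j then 1 else 0) else A x$i$l) * inverse (det (A x)))"
  proof (intro smooth_on_mult smooth_on_inverse smooth_on_det assms)
    fix i l
    show "smooth_on S (\<lambda>x. (\<chi> i l. if l = k then (if i = j then 1 else 0) else A x$i$l) $ i $ l)"
      by (cases "l = k") (simp_all add: smooth_on_const assms)
  qed
  then show ?thesis
    by (rule smooth_on_cong[OF assms(1)]) (simp add: matrix_inv_cramer assms)
qed

text \<open>The mixed second difference is symmetric in \<open>v\<close> and \<open>w\<close>.  Applying the mean value theorem first in the direction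
  \<open>v\<close>, then in the direction \<open>w\<close>, turns it into a value of the mixed second derivative in that order,
  at a point close to \<open>x\<close>.\<close>

lemma second_difference_mvt:
  fixes h :: "'a::euclidean_space \<Rightarrow> real"
  assumes h: "smooth_on (ball x r) h" and t: "0 < t" "t * (norm v + norm w) < r"
  shows "\<exists>y. norm (y - x) \<le> t * (norm v + norm w) \<and>
    h (x + t *\<^sub>R v + t *\<^sub>R w) - h (x + t *\<^sub>R v) - h (x + t *\<^sub>R w) + h x =
    t * t * frechet_derivative (\<lambda>y. frechet_derivative h (at y) v) (at y) w"
proof -
  define Dv where "Dv = (\<lambda>y. frechet_derivative h (at y) v)"
  have in_ball: "x + a *\<^sub>R v + b *\<^sub>R w \<in> ball x r" and
    bound: "norm (a *\<^sub>R v + b *\<^sub>R w) \<le> t * (norm v + norm w)"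
    if "0 \<le> a" "a \<le> t" "0 \<le> b" "b \<le> t" for a b
  proof -
    have "norm (a *\<^sub>R v + b *\<^sub>R w) \<le> a * norm v + b * norm w"
      using norm_triangle_ineq[of "a *\<^sub>R v" "b *\<^sub>R w"] that by simp
    also have "\<dots> \<le> t * (norm v + norm w)"
      using that by (simp add: distrib_left add_mono mult_right_mono)
    finally show "norm (a *\<^sub>R v + b *\<^sub>R w) \<le> t * (norm v + norm w)" .
    then show "x + a *\<^sub>R v + b *\<^sub>R w \<in> ball x r"
      using t(2) by (simp add: dist_norm add.assoc flip: norm_minus_cancel[of "a *\<^sub>R v + b *\<^sub>R w"])
  qed
  have hd: "(h has_derivative frechet_derivative h (at y)) (at y)"
    "(Dv has_derivative frechet_derivative Dv (at y)) (at y)" if "y \<in> ball x r" for y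
    using smooth_on_imp_differentiable[OF h that]
      smooth_on_imp_differentiable[OF smooth_on_frechet[OF h] that, of v]
    by (auto simp: Dv_def intro: has_derivative_frechet)
  have der1: "((\<lambda>a. h (x + a *\<^sub>R v + b *\<^sub>R w)) has_real_derivative Dv (x + a *\<^sub>R v + b *\<^sub>R w)) (at a)"
    if "0 \<le> a" "a \<le> t" "0 \<le> b" "b \<le> t" for a b
  proof -
    have "((\<lambda>a. x + a *\<^sub>R v + b *\<^sub>R w) has_derivative (\<lambda>s. s *\<^sub>R v)) (at a)"
      by (auto intro!: derivative_eq_intros)
    from diff_chain_at[OF this hd(1)[OF in_ball[OF that]]]
    show ?thesis
      unfolding has_field_derivative_def o_def
      by (rule has_derivative_eq_rhs) (use linear_cmul[OF has_derivative_linear[OF hd(1)[OF in_ball[OF that]]]] in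
          \<open>simp add: fun_eq_iff Dv_def mult.commute\<close>)
  qed
  have der2: "((\<lambda>b. Dv (x + a *\<^sub>R v + b *\<^sub>R w)) has_real_derivative
      frechet_derivative Dv (at (x + a *\<^sub>R v + b *\<^sub>R w)) w) (at b)"
    if "0 \<le> a" "a \<le> t" "0 \<le> b" "b \<le> t" for a b
  proof -
    have "((\<lambda>b. x + a *\<^sub>R v + b *\<^sub>R w) has_derivative (\<lambda>s. s *\<^sub>R w)) (at b)"
      by (auto intro!: derivative_eq_intros)
    from diff_chain_at[OF this hd(2)[OF in_ball[OF that]]]
    show ?thesis
      unfolding has_field_derivative_def o_def
      by (rule has_derivative_eq_rhs) (use linear_cmul[OF has_derivative_linear[OF hd(2)[OF in_ball[OF that]]]] in
          \<open>simp add: fun_eq_iff mult.commute\<close>)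
  qed
  have "\<exists>a>0. a < t \<and>
    (h (x + t *\<^sub>R v + t *\<^sub>R w) - h (x + t *\<^sub>R v + 0 *\<^sub>R w)) - (h (x + 0 *\<^sub>R v + t *\<^sub>R w) - h (x + 0 *\<^sub>R v + 0 *\<^sub>R w))
      = (t - 0) * (Dv (x + a *\<^sub>R v + t *\<^sub>R w) - Dv (x + a *\<^sub>R v + 0 *\<^sub>R w))"
    by (rule MVT2[OF t(1)]) (use t(1) in \<open>intro DERIV_diff der1, auto\<close>)
  then obtain a where a: "0 < a" "a < t"
    "(h (x + t *\<^sub>R v + t *\<^sub>R w) - h (x + t *\<^sub>R v)) - (h (x + t *\<^sub>R w) - h x)
      = t * (Dv (x + a *\<^sub>R v + t *\<^sub>R w) - Dv (x + a *\<^sub>R v))"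
    by auto
  have "\<exists>b>0. b < t \<and> Dv (x + a *\<^sub>R v + t *\<^sub>R w) - Dv (x + a *\<^sub>R v + 0 *\<^sub>R w)
      = (t - 0) * frechet_derivative Dv (at (x + a *\<^sub>R v + b *\<^sub>R w)) w"
    by (rule MVT2[OF t(1)]) (use a t(1) in \<open>intro der2, auto\<close>)
  then obtain b where b: "0 < b" "b < t"
    "Dv (x + a *\<^sub>R v + t *\<^sub>R w) - Dv (x + a *\<^sub>R v)
      = t * frechet_derivative Dv (at (x + a *\<^sub>R v + b *\<^sub>R w)) w"
    by auto
  show ?thesis
  proof (intro exI conjI)
    show "norm ((x + a *\<^sub>R v + b *\<^sub>R w) - x) \<le> t * (norm v + norm w)"
      using bound[of a b] a b by (simp add: add.assoc)
    show "h (x + t *\<^sub>R v + t *\<^sub>R w) - h (x + t *\<^sub>R v) - h (x + t *\<^sub>R w) + h x =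
      t * t * frechet_derivative (\<lambda>y. frechet_derivative h (at y) v) (at (x + a *\<^sub>R v + b *\<^sub>R w)) w"
      using a(3) unfolding b(3) by (simp add: Dv_def)
  qed
qed

text \<open>The same second difference equals the mixed derivatives in both orders, at two different nearby
  points; by continuity the values at \<open>x\<close> differ by less than any \<open>e > 0\<close>.\<close>

lemma second_derivative_symmetric_real:
  fixes h :: "'a::euclidean_space \<Rightarrow> real"
  assumes S: "open S" "x \<in> S" and h: "smooth_on S h"
  shows "frechet_derivative (\<lambda>y. frechet_derivative h (at y) v) (at x) w =
         frechet_derivative (\<lambda>y. frechet_derivative h (at y) w) (at x) v"
proof -
  define H where "H v w y = frechet_derivative (\<lambda>y. frechet_derivative h (at y) v) (at y) w" for v w y
  have cont: "continuous_on S (H v w)" for v w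
    unfolding H_def by (intro smooth_on_imp_continuous_on smooth_on_frechet h)
  have "\<bar>H v w x - H w v x\<bar> < e" if "e > 0" for e
  proof -
    have ev: "\<forall>\<^sub>F y in nhds x. y \<in> S \<and> dist (H v w y) (H v w x) < e / 2 \<and> dist (H w v y) (H w v x) < e / 2"
    proof (intro eventually_conj)
      show "\<forall>\<^sub>F y in nhds x. y \<in> S" using S by (rule eventually_nhds_in_open)
      have "(H v w \<longlongrightarrow> H v w x) (nhds x)" for v w
        using cont[of v w] S by (simp add: continuous_on_eq_continuous_at tendsto_at_iff_tendsto_nhds isCont_def)
      from tendstoD[OF this half_gt_zero[OF \<open>e > 0\<close>]]
      show "\<forall>\<^sub>F y in nhds x. dist (H v w y) (H v w x) < e / 2"
        "\<forall>\<^sub>F y in nhds x. dist (H w v y) (H w v x) < e / 2"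
        by blast+
    qed
    then obtain r where r: "r > 0" "\<And>y. dist y x < r \<Longrightarrow>
        y \<in> S \<and> dist (H v w y) (H v w x) < e / 2 \<and> dist (H w v y) (H w v x) < e / 2"
      unfolding eventually_nhds_metric by blast
    have "smooth_on (ball x r) h"
    proof -
      have sub: "Ck_on k T f" if "Ck_on k S f" "T \<subseteq> S" for k T and f :: "'a \<Rightarrow> real"
        using that
        by (induction k arbitrary: f) (auto intro: continuous_on_subset)
      have "ball x r \<subseteq> S" using r(2) by (auto simp: dist_commute)
      then show ?thesis using h sub unfolding smooth_on_def by blast
    qed
    \<comment> \<open>The summand \<open>1\<close> only keeps the denominator positive; what matters is \<open>t * (norm v + norm w) < r\<close>.\<close>
    define t where "t = r / (norm v + norm w + 1)"
    have n: "norm v + norm w + 1 > 0" by (smt (verit) norm_ge_zero)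
    have t: "t > 0" "t * (norm v + norm w) < r"
      using r(1) n by (simp_all add: t_def field_simps)
    from second_difference_mvt[OF \<open>smooth_on (ball x r) h\<close> t]
    obtain y where y: "norm (y - x) \<le> t * (norm v + norm w)"
      "h (x + t *\<^sub>R v + t *\<^sub>R w) - h (x + t *\<^sub>R v) - h (x + t *\<^sub>R w) + h x = t * t * H v w y"
      unfolding H_def by blast
    from second_difference_mvt[OF \<open>smooth_on (ball x r) h\<close> t(1), of w v] t(2)
    obtain z where z: "norm (z - x) \<le> t * (norm v + norm w)"
      "h (x + t *\<^sub>R w + t *\<^sub>R v) - h (x + t *\<^sub>R w) - h (x + t *\<^sub>R v) + h x = t * t * H w v z"
      unfolding H_def by (auto simp: add.commute)
    have swap: "x + t *\<^sub>R w + t *\<^sub>R v = x + t *\<^sub>R v + t *\<^sub>R w" by (simp add: algebra_simps)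
    have "t * t * H v w y = t * t * H w v z"
      using y(2) z(2) unfolding swap by linarith
    then have "H v w y = H w v z" using t(1) by simp
    moreover have "dist (H v w y) (H v w x) < e / 2" "dist (H w v z) (H w v x) < e / 2"
      using r(2)[of y] r(2)[of z] y(1) z(1) t(2) by (auto simp: dist_norm)
    ultimately show ?thesis unfolding dist_real_def by linarith
  qed
  then have "H v w x = H w v x"
    by (metis abs_le_zero_iff eq_iff_diff_eq_0 less_irrefl not_le)
  then show ?thesis by (simp add: H_def)
qed

lemma pd_commute:
  fixes f :: "real^'m::finite \<Rightarrow> 'b::euclidean_space"
  assumes S: "open S" "u \<in> S" and f: "smooth_on S f"
  shows "pd i (pd j f) u = pd j (pd i f) u"
proof (rule euclidean_eqI)
  fix b :: 'b assume "b \<in> Basis"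
  have inner: "frechet_derivative (\<lambda>y. g y \<bullet> b) (at y) w = frechet_derivative g (at y) w \<bullet> b"
    if "smooth_on S g" "y \<in> S" for g :: "real^'m \<Rightarrow> 'b" and y w
    using frechet_derivative_eqI[OF has_derivative_inner_left[OF
          has_derivative_frechet[OF smooth_on_imp_differentiable[OF that]]], of b] by simp
  have eq: "pd i (pd j f) u \<bullet> b = frechet_derivative (\<lambda>y. frechet_derivative (\<lambda>y. f y \<bullet> b) (at y) (axis j 1)) (at u) (axis i 1)" for i j
  proof -
    have "pd i (pd j f) u \<bullet> b = frechet_derivative (\<lambda>y. pd j f y \<bullet> b) (at u) (axis i 1)"
      unfolding pd_def[of i] using inner[OF smooth_on_pd[OF f] S(2)] by simp
    also have "frechet_derivative (\<lambda>y. pd j f y \<bullet> b) (at u) =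
        frechet_derivative (\<lambda>y. frechet_derivative (\<lambda>y. f y \<bullet> b) (at y) (axis j 1)) (at u)"
      by (rule frechet_derivative_cong_on_open[OF S]) (simp add: inner f pd_def)
    finally show ?thesis .
  qed
  have "smooth_on S (\<lambda>y. f y \<bullet> b)"
    by (intro smooth_on_inner S f smooth_on_const)
  from second_derivative_symmetric_real[OF S this]
  show "pd i (pd j f) u \<bullet> b = pd j (pd i f) u \<bullet> b"
    unfolding eq by blast
qed

section \<open>Frames and oriented planes\<close>

lemma mult_transpose_nth:
  fixes X :: "real^'n::finite^'m::finite" and Y :: "real^'n^'k::finite"
  shows "(X ** transpose Y) $ i $ j = X $ i \<bullet> Y $ j"
  by (simp add: matrix_matrix_mult_def transpose_def inner_vec_def)

lemma orthonormal_frame_iff: "orthonormal_frame X \<longleftrightarrow> X ** transpose X = mat 1"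
  by (simp add: orthonormal_frame_def vec_eq_iff mult_transpose_nth mat_def)

lemma matrix_add_mult_distrib:
  fixes A B :: "real^'n::finite^'m::finite" and C :: "real^'k::finite^'n"
  shows "(A + B) ** C = A ** C + B ** C" "(A - B) ** C = A ** C - B ** C"
  by (simp_all add: vec_eq_iff matrix_matrix_mult_def distrib_right left_diff_distrib sum.distrib sum_subtractf)

lemma matrix_mult_add_distrib:
  fixes A :: "real^'n::finite^'m::finite" and B C :: "real^'k::finite^'n"
  shows "A ** (B + C) = A ** B + A ** C" "A ** (B - C) = A ** B - A ** C"
  by (simp_all add: vec_eq_iff matrix_matrix_mult_def distrib_left right_diff_distrib sum.distrib sum_subtractf)

lemma transpose_add_diff:
  fixes A B :: "real^'n::finite^'m::finite"
  shows "transpose (A + B) = transpose A + transpose B" "transpose (A - B) = transpose A - transpose B"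
  by (simp_all add: vec_eq_iff transpose_def)

lemma row_mult: "(L ** Y) $ i = L $ i v* (Y :: real^'n::finite^'m::finite)"
  by (simp add: vec_eq_iff matrix_matrix_mult_def vector_matrix_mult_def mult.commute)

lemma det_matrix_inv_pos:
  fixes K :: "real^'m::finite^'m"
  assumes "det K > 0"
  shows "det (matrix_inv K) > 0"
proof -
  have "det K * det (matrix_inv K) = 1"
    using invertible_right_inverse_inv(1)[of K] assms det_mul[of K "matrix_inv K"] by simp
  with assms show ?thesis by (metis zero_less_mult_pos zero_less_one)
qed

lemma same_orientation_trans:
  assumes "same_orientation X Y" "same_orientation Y Z"
  shows "same_orientation X Z"
proof -
  obtain K L where "det K > 0" "X = K ** Y" "det L > 0" "Y = L ** Z"
    using assms unfolding same_orientation_def by auto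
  then have "det (K ** L) > 0" "X = (K ** L) ** Z"
    by (simp_all add: det_mul matrix_mul_assoc)
  then show ?thesis unfolding same_orientation_def by blast
qed

lemma same_orientation_sym:
  assumes "same_orientation X Y"
  shows "same_orientation Y X"
proof -
  obtain K where K: "det K > 0" "X = K ** Y"
    using assms unfolding same_orientation_def by auto
  then have "Y = matrix_inv K ** X"
    using invertible_right_inverse_inv(2)[of K] by (simp add: matrix_mul_assoc)
  then show ?thesis
    using det_matrix_inv_pos[OF K(1)] unfolding same_orientation_def by blast
qed

lemma oplane_cong: "same_orientation X Y \<Longrightarrow> oplane X = oplane Y"
  unfolding oplane_def using same_orientation_trans same_orientation_sym by blast

lemma oplane_eq_imp_same_orientation:
  assumes "Z \<in> oplane X" "oplane X = oplane Y"
  shows "same_orientation X Y"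
  using assms unfolding oplane_def using same_orientation_trans same_orientation_sym by blast

text \<open>If the Gram matrix annihilates \<open>v\<close>, then the combination \<open>v v* Y\<close> of the rows is orthogonal to all
  rows, in particular to itself.\<close>

lemma gram_det_nonzero:
  fixes Y :: "real^'n::finite^'m::finite"
  assumes "inj (\<lambda>v. v v* Y)"
  shows "det (Y ** transpose Y) \<noteq> 0"
proof -
  have "v = 0" if "(Y ** transpose Y) *v v = 0" for v
  proof -
    have "Y *v (v v* Y) = 0"
      using that by (simp flip: matrix_vector_mul_assoc)
    then have "(v v* Y) \<bullet> (v v* Y) = 0"
      by (simp add: dot_lmul_matrix)
    then have "v v* Y = 0 v* Y" by simp
    then show "v = 0" using assms by (blast dest: injD)
  qed
  then show ?thesis
    using invertible_left_inverse invertible_det_nz matrix_left_invertible_ker by metis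
qed

text \<open>The second statement is what allows traces with respect to the metric, taken with the inverse
  Gram matrix, to be computed in an orthonormal frame and conversely.\<close>

lemma orthonormal_change_of_frame:
  fixes Y :: "real^'n::finite^'m::finite"
  assumes "orthonormal_frame (L ** Y)"
  shows "det L \<noteq> 0" and "transpose L ** L = matrix_inv (Y ** transpose Y)"
proof -
  let ?g = "Y ** transpose Y"
  have 1: "L ** (?g ** transpose L) = mat 1"
    using assms by (simp add: orthonormal_frame_iff matrix_transpose_mul matrix_mul_assoc)
  then have "det L * det (?g ** transpose L) = 1"
    by (metis det_I det_mul)
  then show "det L \<noteq> 0" by auto
  from 1 have "(?g ** transpose L) ** L = mat 1"
    using matrix_left_right_inverse by blast
  then have 2: "?g ** (transpose L ** L) = mat 1"
    by (simp add: matrix_mul_assoc)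
  then have "det ?g * det (transpose L ** L) = 1"
    by (metis det_I det_mul)
  then have "det ?g \<noteq> 0" by auto
  then have "(matrix_inv ?g ** ?g) ** (transpose L ** L) = transpose L ** L"
    using invertible_right_inverse_inv(2)[of ?g] by simp
  then show "transpose L ** L = matrix_inv ?g"
    unfolding matrix_mul_assoc[symmetric, of _ ?g] 2 by simp
qed

lemma ex_orthonormal_frame_of_plane:
  fixes Y :: "real^'n::finite^'m::finite"
  assumes "inj (\<lambda>v. v v* Y)"
  shows "\<exists>L :: real^'m^'m. orthonormal_frame (L ** Y)"
proof -
  let ?S = "range (\<lambda>v. v v* Y)"
  have lin: "linear (\<lambda>v. v v* Y)"
    using matrix_vector_mul_linear[of "transpose Y"] by simp
  have "subspace ?S"
    using linear_subspace_image[OF lin subspace_UNIV] by simp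
  then obtain B where B: "B \<subseteq> ?S" "pairwise orthogonal B" "\<And>x. x \<in> B \<Longrightarrow> norm x = 1"
    "independent B" "card B = dim ?S" "span B = ?S"
    using orthonormal_basis_subspace by blast
  have "dim ?S = CARD('m)"
    using dim_image_eq[OF lin, of UNIV] assms by simp
  then obtain b :: "'m \<Rightarrow> real^'n" where b: "bij_betw b UNIV B"
    using B(4,5) independent_imp_finite[of B] finite_same_card_bij[of "UNIV :: 'm set" B] by auto
  have "\<forall>i. \<exists>v. b i = v v* Y"
    using b B(1) by (auto simp: bij_betw_def)
  then obtain l where l: "\<And>i. b i = l i v* Y" by metis
  have "orthonormal_frame ((\<chi> i. l i) ** Y)"
    unfolding orthonormal_frame_def
  proof (intro allI)
    fix i j
    have "b i \<in> B" "b j \<in> B" "b i = b j \<longleftrightarrow> i = j"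
      using b by (auto simp: bij_betw_def inj_on_def)
    then have "b i \<bullet> b j = (if i = j then 1 else 0)"
      using B(2,3) by (auto simp: pairwise_def orthogonal_def norm_eq_1)
    then show "((\<chi> i. l i) ** Y) $ i \<bullet> ((\<chi> i. l i) ** Y) $ j = (if i = j then 1 else 0)"
      by (simp add: row_mult l)
  qed
  then show ?thesis by blast
qed

text \<open>An orthonormal frame of the plane exists; if its orientation is the wrong one, reversing one of
  its vectors corrects it.\<close>

lemma oplane_nonempty:
  fixes Y :: "real^'n::finite^'m::finite"
  assumes "inj (\<lambda>v. v v* Y)"
  shows "oplane Y \<noteq> {}"
proof -
  obtain L :: "real^'m^'m" where L: "orthonormal_frame (L ** Y)"
    using ex_orthonormal_frame_of_plane[OF assms] by blast
  obtain k :: 'm where True by simp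
  \<comment> \<open>\<open>D\<close> multiplies the \<open>k\<close>-th vector of the frame by the sign of \<open>det L\<close>.\<close>
  define d where "d i = (if i = k then sgn (det L) else 1)" for i
  define D :: "real^'m^'m" where "D = (\<chi> i j. if i = j then d i else 0)"
  have nz: "det L \<noteq> 0" by (rule orthonormal_change_of_frame[OF L])
  have "det D = (\<Prod>i\<in>UNIV. d i)"
    unfolding D_def by (subst det_diagonal) auto
  also have "\<dots> = sgn (det L)" by (simp add: d_def)
  finally have "det (D ** L) > 0"
    using nz by (simp add: det_mul sgn_if)
  moreover have "orthonormal_frame (D ** L ** Y)"
  proof -
    have "(\<Sum>l\<in>UNIV. D $ i $ l * D $ j $ l) = (if i = j then 1 else 0)" for i j
    proof -
      have "(\<Sum>l\<in>UNIV. D $ i $ l * D $ j $ l) = (\<Sum>l\<in>UNIV. if l = i then d i * D $ j $ i else 0)"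
        by (intro sum.cong) (auto simp: D_def)
      also have "\<dots> = d i * D $ j $ i" by simp
      also have "\<dots> = (if i = j then 1 else 0)"
        using nz by (simp add: D_def d_def sgn_if)
      finally show ?thesis .
    qed
    then have "D ** transpose D = mat 1"
      by (simp add: vec_eq_iff matrix_matrix_mult_def transpose_def mat_def)
    moreover have "(D ** L ** Y) ** transpose (D ** L ** Y) =
        D ** ((L ** Y) ** transpose (L ** Y)) ** transpose D"
      by (simp add: matrix_transpose_mul matrix_mul_assoc)
    ultimately show ?thesis
      using L by (simp add: orthonormal_frame_iff)
  qed
  ultimately have "D ** L ** Y \<in> oplane Y"
    unfolding oplane_def same_orientation_def by blast
  then show ?thesis by blast
qed

lemma span_rows: "span (rows (Y :: real^'n::finite^'m::finite)) = range (\<lambda>v. v v* Y)"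
proof
  have lin: "linear (\<lambda>v. v v* Y)"
    using matrix_vector_mul_linear[of "transpose Y"] by simp
  have "row i Y = axis i 1 v* Y" for i
    by (simp add: vec_eq_iff row_def vector_matrix_mult_def axis_def if_distrib if_distribR cong: if_cong)
  then have "rows Y \<subseteq> range (\<lambda>v. v v* Y)"
    by (auto simp: rows_def)
  then show "span (rows Y) \<subseteq> range (\<lambda>v. v v* Y)"
    using linear_subspace_image[OF lin subspace_UNIV] by (intro span_minimal) simp_all
  have "v v* Y = (\<Sum>i\<in>UNIV. v $ i *\<^sub>R row i Y)" for v
    by (simp add: vec_eq_iff row_def vector_matrix_mult_def)
  moreover have "(\<Sum>i\<in>UNIV. v $ i *\<^sub>R row i Y) \<in> span (rows Y)" for v
    by (intro span_sum span_scale span_base) (auto simp: rows_def)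
  ultimately show "range (\<lambda>v. v v* Y) \<subseteq> span (rows Y)" by auto
qed

lemma same_orientation_span:
  fixes X Y :: "real^'n::finite^'m::finite"
  assumes "same_orientation X Y"
  shows "range (\<lambda>v. v v* X) = range (\<lambda>v. v v* Y)"
proof -
  have "range (\<lambda>v. v v* X) \<subseteq> range (\<lambda>v. v v* Y)" if "same_orientation X Y" for X Y :: "real^'n^'m"
    using that unfolding same_orientation_def by (auto simp flip: vector_matrix_mul_assoc)
  then show ?thesis
    using assms same_orientation_sym by (metis subset_antisym)
qed

lemma plane_of_oplane:
  assumes "X \<in> oplane Y"
  shows "plane_of (oplane Y) = range (\<lambda>v. v v* X)" "plane_of (oplane Y) = range (\<lambda>v. v v* Y)"
proof -
  have "span (rows Z) = range (\<lambda>v. v v* Y)" if "Z \<in> oplane Y" for Z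
    using that same_orientation_span[of Z Y] by (simp add: oplane_def span_rows)
  then show "plane_of (oplane Y) = range (\<lambda>v. v v* Y)"
    using assms by (auto simp: plane_of_def)
  then show "plane_of (oplane Y) = range (\<lambda>v. v v* X)"
    using assms same_orientation_span[of X Y] by (simp add: oplane_def)
qed

lemma orthogonal_comp_oplane:
  assumes "X \<in> oplane Y"
  shows "y \<in> orthogonal_comp (plane_of (oplane Y)) \<longleftrightarrow> X *v y = 0"
proof
  assume "y \<in> orthogonal_comp (plane_of (oplane Y))"
  then have "(v v* X) \<bullet> y = 0" for v
    by (auto simp: orthogonal_comp_def orthogonal_def plane_of_oplane(1)[OF assms])
  then show "X *v y = 0"
    by (metis dot_lmul_matrix inner_eq_zero_iff)
next
  assume "X *v y = 0"
  then show "y \<in> orthogonal_comp (plane_of (oplane Y))"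
    by (auto simp: orthogonal_comp_def orthogonal_def plane_of_oplane(1)[OF assms] dot_lmul_matrix)
qed

section \<open>The charts and the metric of the Grassmannian\<close>

lemma grass_tangent_iff:
  assumes "X \<in> oplane Y"
  shows "T \<in> grass_tangent (oplane Y) \<longleftrightarrow>
    (\<forall>v. X *v (T *v (v v* X)) = 0) \<and> (\<forall>y. X *v y = 0 \<longrightarrow> T *v y = 0)"
proof -
  have R: "orthogonal_comp (plane_of (oplane Y)) = {y. X *v y = 0}"
    using orthogonal_comp_oplane[OF assms] by blast
  show ?thesis
    unfolding grass_tangent_def unfolding R unfolding plane_of_oplane(1)[OF assms] by auto
qed

lemma displaced_frame: "(\<chi> j. X $ j + T *v (X $ j)) = X + X ** transpose (T :: real^'n::finite^'n)"
  by (simp add: vec_eq_iff row_mult)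

text \<open>If the frame \<open>Y\<close> projects to a positively oriented basis of the reference plane, then the
  normalized frame \<open>Z = (Y X\<^sup>T)\<^sup>-\<^sup>1 Y\<close> spans the same plane and projects exactly to \<open>X\<close>.  Hence \<open>Z\<^sub>j = X\<^sub>j + T X\<^sub>j\<close>
  for a linear map \<open>T\<close> from the plane to its orthogonal complement, and this \<open>T = Z\<^sup>T X - X\<^sup>T X\<close> is the chart value.
  It is unique, as a change of frame between two such graphs projects to the identity.\<close>

lemma grass_chart_oplane:
  fixes X Y Y0 :: "real^'n::finite^'m::finite"
  assumes X: "X \<in> oplane Y0" and Y: "inj (\<lambda>v. v v* Y)" and pos: "det (Y ** transpose X) > 0"
  shows "grass_chart (oplane Y0) (oplane Y) =
    transpose (matrix_inv (Y ** transpose X) ** Y) ** X - transpose X ** X"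
proof -
  define B where "B = matrix_inv (Y ** transpose X)"
  define Z where "Z = B ** Y"
  define T0 where "T0 = transpose Z ** X - transpose X ** X"
  have XX: "X ** transpose X = mat 1"
    using X by (simp add: oplane_def orthonormal_frame_iff)
  have ZX: "Z ** transpose X = mat 1"
    using invertible_right_inverse_inv(2)[of "Y ** transpose X"] pos
    by (simp add: Z_def B_def flip: matrix_mul_assoc)
  then have XZ: "X ** transpose Z = mat 1"
    by (metis matrix_transpose_mul transpose_mat transpose_transpose)
  have tan: "T0 \<in> grass_tangent (oplane Y0)"
    unfolding grass_tangent_iff[OF X]
  proof (intro conjI allI impI)
    fix v
    have "X *v (T0 *v (v v* X)) = (X ** T0 ** transpose X) *v v"
      by (simp flip: matrix_vector_mul_assoc)
    also have "X ** T0 ** transpose X = (X ** transpose Z) ** (X ** transpose X) - (X ** transpose X) ** (X ** transpose X)"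
      by (simp add: T0_def matrix_mult_add_distrib matrix_add_mult_distrib matrix_mul_assoc)
    finally show "X *v (T0 *v (v v* X)) = 0"
      by (simp add: XX XZ)
  next
    fix y assume "X *v y = 0"
    then show "T0 *v y = 0"
      by (simp add: T0_def matrix_vector_mult_diff_rdistrib flip: matrix_vector_mul_assoc)
  qed
  have graph: "oplane Y = oplane (\<chi> j. X' $ j + T0 *v (X' $ j))" if "X' \<in> oplane Y0" for X'
  proof -
    have "same_orientation X' X"
      using that X same_orientation_trans same_orientation_sym unfolding oplane_def by blast
    then obtain K where K: "det K > 0" "X' = K ** X"
      unfolding same_orientation_def by blast
    have "X + X ** transpose T0 = X + (X ** transpose X) ** Z - (X ** transpose X) ** X"
      by (simp add: T0_def matrix_transpose_mul transpose_add_diff matrix_mult_add_distrib matrix_mul_assoc)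
    then have "X + X ** transpose T0 = Z" by (simp add: XX)
    then have "X' + X' ** transpose T0 = (K ** B) ** Y"
      by (metis K(2) Z_def matrix_mul_assoc matrix_mult_add_distrib(1))
    moreover have "det (K ** B) > 0"
      using K(1) det_matrix_inv_pos[OF pos] by (simp add: det_mul B_def)
    ultimately show ?thesis
      unfolding displaced_frame by (metis oplane_cong same_orientation_def)
  qed
  \<comment> \<open>Two graphs over the same plane that coincide have frames related by some \<open>K\<close>; multiplying by
    \<open>X\<^sup>T\<close>, which kills the normal parts, shows that \<open>K\<close> is the identity.\<close>
  have uniq: "T = T0" if T: "T \<in> grass_tangent (oplane Y0)"
    "\<forall>X'\<in>oplane Y0. oplane Y = oplane (\<chi> j. X' $ j + T *v (X' $ j))" for T
  proof -
    obtain W where "W \<in> oplane Y" using oplane_nonempty[OF Y] by blast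
    moreover have "oplane Y = oplane (X + X ** transpose T)" "oplane Y = oplane (X + X ** transpose T0)"
      using T(2) graph X by (auto simp flip: displaced_frame)
    ultimately have "same_orientation (X + X ** transpose T) (X + X ** transpose T0)"
      using oplane_eq_imp_same_orientation by metis
    then obtain K where K: "X + X ** transpose T = K ** (X + X ** transpose T0)"
      unfolding same_orientation_def by blast
    have normal: "X ** transpose T ** transpose X = 0" if "T \<in> grass_tangent (oplane Y0)" for T
    proof -
      have "(X ** T ** transpose X) *v v = 0" for v
        using that unfolding grass_tangent_iff[OF X] by (simp flip: matrix_vector_mul_assoc)
      then have "X ** T ** transpose X = 0"
        by (simp add: matrix_eq)
      then have "transpose (X ** T ** transpose X) = 0"
        by (simp add: vec_eq_iff transpose_def)
      then show ?thesis by (simp add: matrix_transpose_mul matrix_mul_assoc)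
    qed
    have "(X + X ** transpose T) ** transpose X = K ** ((X + X ** transpose T0) ** transpose X)"
      by (simp add: K matrix_mul_assoc)
    then have "K = mat 1"
      by (simp add: matrix_add_mult_distrib normal T(1) tan XX)
    then have "X ** transpose T = X ** transpose T0"
      using K by simp
    then have "T ** transpose X = T0 ** transpose X"
      by (metis matrix_transpose_mul transpose_transpose)
    then have on_plane: "T *v (v v* X) = T0 *v (v v* X)" for v
      by (metis matrix_vector_mul_assoc transpose_matrix_vector)
    have "T *v y = T0 *v y" for y
    proof -
      \<comment> \<open>the orthogonal projection of \<open>y\<close> to the plane\<close>
      let ?p = "(X *v y) v* X"
      have "X *v ?p = (X ** transpose X) *v (X *v y)"
        by (simp flip: matrix_vector_mul_assoc)
      then have "X *v (y - ?p) = 0"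
        by (simp add: XX matrix_vector_mult_diff_distrib)
      then have "T *v (y - ?p) = 0" "T0 *v (y - ?p) = 0"
        using T(1) tan unfolding grass_tangent_iff[OF X] by blast+
      then show ?thesis
        using on_plane[of "X *v y"] by (simp add: matrix_vector_mult_diff_distrib)
    qed
    then show ?thesis by (simp add: matrix_eq)
  qed
  have "grass_chart (oplane Y0) (oplane Y) = T0"
    unfolding grass_chart_def using tan graph uniq by (intro the_equality) auto
  then show ?thesis by (simp add: T0_def Z_def B_def)
qed

lemma bounded_bilinear_matrix_mult:
  "bounded_bilinear ((**) :: real^'n::finite^'m::finite \<Rightarrow> real^'k::finite^'n \<Rightarrow> real^'k^'m)"
  unfolding bilinear_conv_bounded_bilinear[symmetric] bilinear_def
  by (intro conjI allI linearI)
    (simp_all add: matrix_add_mult_distrib matrix_mult_add_distrib vec_eq_iff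
      matrix_matrix_mult_def sum_distrib_left sum.distrib algebra_simps)

lemma bounded_linear_transpose: "bounded_linear (transpose :: real^'n::finite^'m::finite \<Rightarrow> real^'m^'n)"
  unfolding linear_conv_bounded_linear[symmetric]
  by (intro linearI) (simp_all add: vec_eq_iff transpose_def)

lemma differentiable_matrixI:
  fixes A :: "'a::real_normed_vector \<Rightarrow> real^'n::finite^'m::finite"
  assumes "\<And>i j. (\<lambda>x. A x $ i $ j) differentiable (at x)"
  shows "A differentiable (at x)"
  unfolding differentiable_componentwise_within[of A]
  using assms by (auto simp: Basis_vec_def inner_axis)

lemma smooth_on_matrix_entry: "open S \<Longrightarrow> smooth_on S (\<lambda>A :: real^'n::finite^'m::finite. A $ i $ j)"
proof -
  assume S: "open S"
  have "smooth_on S (\<lambda>A :: real^'n^'m. A)"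
    unfolding smooth_on_def
  proof
    fix k show "Ck_on k S (\<lambda>A :: real^'n^'m. A)"
      by (cases k) (simp_all add: Ck_on_const)
  qed
  then show ?thesis
    by (intro smooth_on_bounded_linear[OF bounded_linear_vec_nth] S)
qed

lemma open_det_nonzero: "open {A :: real^'m::finite^'m. det A \<noteq> 0}"
  and open_det_pos: "open {A :: real^'m::finite^'m. det A > 0}"
proof -
  have "continuous_on UNIV (\<lambda>A :: real^'m^'m. det A)"
    by (intro smooth_on_imp_continuous_on smooth_on_det smooth_on_matrix_entry open_UNIV)
  then show "open {A :: real^'m::finite^'m. det A \<noteq> 0}" "open {A :: real^'m::finite^'m. det A > 0}"
    by (auto intro!: open_Collect_neq open_Collect_less continuous_on_const)
qed

text \<open>Matrix inversion is smooth on the open set of invertible matrices, regarded as a subset of a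
  Euclidean space.\<close>

lemma matrix_inv_differentiable:
  fixes A :: "real^'m::finite^'m"
  assumes "det A \<noteq> 0"
  shows "matrix_inv differentiable (at A)"
  using assms smooth_on_matrix_inv[OF open_det_nonzero smooth_on_matrix_entry[OF open_det_nonzero]]
  by (intro differentiable_matrixI) (auto intro: smooth_on_imp_differentiable)

text \<open>The velocity of a moving plane spanned by \<open>Y(w)\<close>: it maps each combination of the frame vectors to
  the component, orthogonal to the plane, of the derivative of that combination.  Since
  \<open>1 - X\<^sup>T X\<close> is the projection to the orthogonal complement, this is the last formula.\<close>

lemma grass_chart_has_derivative:
  fixes Y :: "real^'d::finite \<Rightarrow> real^'n::finite^'m::finite"
  assumes Y: "(Y has_derivative Y') (at u)" and X: "X \<in> oplane (Y u)"
    and S: "open S" "u \<in> S" "\<And>w. w \<in> S \<Longrightarrow> inj (\<lambda>v. v v* Y w)"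
  shows "\<exists>D. ((\<lambda>w. grass_chart (oplane (Y u)) (oplane (Y w))) has_derivative D) (at u) \<and>
    (\<forall>v c. D v *v (c v* Y u) = c v* (Y' v - Y' v ** transpose X ** X))"
proof -
  define A where "A w = Y w ** transpose X" for w
  define Z where "Z w = matrix_inv (A w) ** Y w" for w
  obtain L where L: "det L > 0" "X = L ** Y u" and "orthonormal_frame X"
    using X unfolding oplane_def same_orientation_def by blast
  then have XX: "X ** transpose X = mat 1"
    by (simp add: orthonormal_frame_iff)
  then have LA: "L ** A u = mat 1"
    by (simp add: A_def L(2) matrix_mul_assoc)
  have "det L * det (A u) = 1"
    using LA by (metis det_I det_mul)
  then have posu: "det (A u) > 0" using L(1) by (metis zero_less_mult_pos zero_less_one)
  have AL: "A u ** L = mat 1" using LA matrix_left_right_inverse by blast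
  then have "matrix_inv (A u) = L"
    using invertible_right_inverse_inv(2)[of "A u"] posu
    by (metis less_irrefl matrix_mul_assoc matrix_mul_lid matrix_mul_rid)
  then have Zu: "Z u = X" by (simp add: Z_def L(2))
  have dA: "(A has_derivative (\<lambda>v. Y' v ** transpose X)) (at u)"
    unfolding A_def
    by (rule bounded_linear.has_derivative[OF bounded_bilinear.bounded_linear_left[OF bounded_bilinear_matrix_mult] Y])
  have "\<forall>\<^sub>F w in nhds u. det (A w) > 0 \<and> w \<in> S"
  proof (intro eventually_conj)
    have "(A \<longlongrightarrow> A u) (nhds u)"
      using has_derivative_continuous[OF dA] by (simp add: tendsto_at_iff_tendsto_nhds isCont_def)
    from topological_tendstoD[OF this open_det_pos] posu
    show "\<forall>\<^sub>F w in nhds u. det (A w) > 0" by simp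
    show "\<forall>\<^sub>F w in nhds u. w \<in> S" by (rule eventually_nhds_in_open[OF S(1,2)])
  qed
  then obtain S' where S': "open S'" "u \<in> S'" "\<And>w. w \<in> S' \<Longrightarrow> det (A w) > 0 \<and> w \<in> S"
    unfolding eventually_nhds by blast
  have "(\<lambda>w. matrix_inv (A w)) differentiable (at u)"
    using differentiable_chain_at[OF _ matrix_inv_differentiable, of A u] dA posu
    by (auto simp: o_def differentiable_def)
  then have "Z differentiable (at u)"
    unfolding Z_def differentiable_def using bounded_bilinear.FDERIV[OF bounded_bilinear_matrix_mult _ Y] by blast
  then obtain Z' where Z': "(Z has_derivative Z') (at u)" by (auto simp: differentiable_def)
  \<comment> \<open>The derivative of \<open>Z\<close> is found by differentiating \<open>A Z = Y\<close>, so that the derivative of the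
    inverse need not be known.\<close>
  have "((\<lambda>w. A w ** Z w) has_derivative (\<lambda>v. A u ** Z' v + (Y' v ** transpose X) ** Z u)) (at u)"
    by (rule bounded_bilinear.FDERIV[OF bounded_bilinear_matrix_mult dA Z'])
  moreover have "((\<lambda>w. A w ** Z w) has_derivative Y') (at u)"
  proof (rule has_derivative_transform_within_open[OF Y S'(1,2)])
    fix w assume "w \<in> S'"
    then show "Y w = A w ** Z w"
      using S'(3)[of w] invertible_right_inverse_inv(1)[of "A w"]
      by (simp add: Z_def matrix_mul_assoc)
  qed
  ultimately have "Y' = (\<lambda>v. A u ** Z' v + (Y' v ** transpose X) ** Z u)"
    by (rule has_derivative_unique[symmetric])
  then have AZ': "A u ** Z' v = Y' v - Y' v ** transpose X ** X" for v
    by (metis Zu add_diff_cancel_right')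
  define D where "D v = transpose (Z' v) ** X" for v
  have "((\<lambda>w. transpose (Z w) ** X - transpose X ** X) has_derivative D) (at u)"
    unfolding D_def
    using has_derivative_diff[OF bounded_linear.has_derivative[OF
       bounded_bilinear.bounded_linear_left[OF bounded_bilinear_matrix_mult]
       bounded_linear.has_derivative[OF bounded_linear_transpose Z']] has_derivative_const] by simp
  then have "((\<lambda>w. grass_chart (oplane (Y u)) (oplane (Y w))) has_derivative D) (at u)"
    by (rule has_derivative_transform_within_open[OF _ S'(1,2)])
      (use S' S(3) in \<open>simp add: grass_chart_oplane[OF X] A_def Z_def\<close>)
  moreover have "D v *v (c v* Y u) = c v* (Y' v - Y' v ** transpose X ** X)" for v c
  proof -
    have Yu: "Y u = A u ** X" by (simp add: L(2) matrix_mul_assoc AL)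
    have "D v *v (c v* Y u) = transpose (Z' v) *v ((X ** transpose X) *v (c v* A u))"
      by (simp add: D_def Yu flip: matrix_vector_mul_assoc vector_matrix_mul_assoc del: transpose_matrix_vector)
        (simp add: flip: matrix_vector_mul_assoc)
    also have "\<dots> = c v* (A u ** Z' v)"
      by (simp add: XX vector_matrix_mul_assoc)
    finally show ?thesis by (simp add: AZ')
  qed
  ultimately show ?thesis by blast
qed

lemma inner_sum_orthonormal_basis:
  fixes x y :: "'a::euclidean_space"
  assumes N: "pairwise orthogonal N" "\<And>a. a \<in> N \<Longrightarrow> norm a = 1" and xy: "x \<in> span N"
  shows "(\<Sum>a\<in>N. (x \<bullet> a) * (y \<bullet> a)) = x \<bullet> y"
proof -
  have "0 \<notin> N" using N(2) by fastforce
  then have "finite N"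
    using pairwise_orthogonal_independent[OF N(1)] independent_imp_finite by blast
  then have "(\<Sum>a\<in>N. (x \<bullet> a) *\<^sub>R a) = x"
    using orthonormal_basis_expand[OF N(1) N(2) xy] by blast
  then have "x \<bullet> y = (\<Sum>a\<in>N. (x \<bullet> a) *\<^sub>R a) \<bullet> y" by simp
  also have "\<dots> = (\<Sum>a\<in>N. (x \<bullet> a) * (y \<bullet> a))"
    by (simp add: inner_sum_left inner_commute[of y])
  finally show ?thesis by simp
qed

text \<open>Two choices enter the definition of the metric.  The orthonormal basis of the normal space
  disappears by Parseval's identity, since the values of \<open>S\<close> are normal, and the orthonormal frame of
  the plane is replaced by an arbitrary frame \<open>Y\<close> at the cost of the inverse Gram matrix.\<close>

lemma grass_metric_eq:
  fixes Y :: "real^'n::finite^'m::finite"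
  assumes Y: "inj (\<lambda>v. v v* Y)"
    and S: "\<And>c. S *v (c v* Y) \<in> orthogonal_comp (plane_of (oplane Y))"
  shows "grass_metric (oplane Y) S T =
    (\<Sum>k\<in>UNIV. \<Sum>l\<in>UNIV. matrix_inv (Y ** transpose Y) $ k $ l * ((S *v (Y $ k)) \<bullet> (T *v (Y $ l))))"
proof -
  define P where "P = oplane Y"
  define X where "X = (SOME X. X \<in> P)"
  define N where "N = (SOME N. pairwise orthogonal N \<and> (\<forall>a\<in>N. norm a = 1) \<and>
                       span N = orthogonal_comp (plane_of P))"
  have "\<exists>N. pairwise orthogonal N \<and> (\<forall>a\<in>N. norm a = 1) \<and> span N = orthogonal_comp (plane_of P)"
    using orthonormal_basis_subspace[OF subspace_orthogonal_comp[of "plane_of P"]] by metis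
  from someI_ex[OF this] have N: "pairwise orthogonal N" "\<And>a. a \<in> N \<Longrightarrow> norm a = 1"
    "span N = orthogonal_comp (plane_of P)"
    unfolding N_def by blast+
  have "X \<in> oplane Y"
    unfolding X_def P_def using oplane_nonempty[OF Y] by (simp add: some_in_eq)
  then obtain L where L: "X = L ** Y" "orthonormal_frame (L ** Y)"
    unfolding oplane_def same_orientation_def by blast
  have X: "X $ j = (\<Sum>k\<in>UNIV. L $ j $ k *\<^sub>R Y $ k)" for j
    by (simp add: L(1) vec_eq_iff matrix_matrix_mult_def)
  have "grass_metric P S T = (\<Sum>j\<in>UNIV. \<Sum>a\<in>N. ((S *v (X $ j)) \<bullet> a) * ((T *v (X $ j)) \<bullet> a))"
    by (simp add: grass_metric_def Let_def X_def N_def)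
  also have "\<dots> = (\<Sum>j\<in>UNIV. (S *v (X $ j)) \<bullet> (T *v (X $ j)))"
    using S by (intro sum.cong inner_sum_orthonormal_basis N refl)
      (simp_all add: N(3) P_def L(1) row_mult)
  also have "\<dots> = (\<Sum>j\<in>UNIV. \<Sum>k\<in>UNIV. \<Sum>l\<in>UNIV. L $ j $ k * L $ j $ l * ((S *v (Y $ k)) \<bullet> (T *v (Y $ l))))"
  proof -
    have "R *v (X $ j) = (\<Sum>k\<in>UNIV. L $ j $ k *\<^sub>R (R *v (Y $ k)))" for R :: "real^'n^'n" and j
      unfolding X by (simp add: linear_sum[OF matrix_vector_mul_linear] matrix_vector_mult_scaleR)
    then show ?thesis
      by (simp only: inner_sum_left) (simp add: inner_sum_right sum_distrib_left mult.left_commute mult.assoc)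
  qed
  also have "\<dots> = (\<Sum>k\<in>UNIV. \<Sum>l\<in>UNIV. (\<Sum>j\<in>UNIV. L $ j $ k * L $ j $ l) * ((S *v (Y $ k)) \<bullet> (T *v (Y $ l))))"
    by (subst sum.swap, rule sum.cong[OF refl], subst sum.swap) (simp add: sum_distrib_right)
  also have "\<dots> = (\<Sum>k\<in>UNIV. \<Sum>l\<in>UNIV. matrix_inv (Y ** transpose Y) $ k $ l * ((S *v (Y $ k)) \<bullet> (T *v (Y $ l))))"
  proof -
    have "(\<Sum>j\<in>UNIV. L $ j $ k * L $ j $ l) = matrix_inv (Y ** transpose Y) $ k $ l" for k l
      unfolding orthonormal_change_of_frame(2)[OF L(2), symmetric]
      by (simp add: matrix_matrix_mult_def transpose_def)
    then show ?thesis by simp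
  qed
  finally show ?thesis by (simp add: P_def)
qed

section \<open>Submanifold geometry in a chart\<close>

lemma pd_cong_on_open:
  assumes "open S" "u \<in> S" "\<And>w. w \<in> S \<Longrightarrow> f w = g w"
  shows "pd i f u = pd i g u"
  unfolding pd_def using frechet_derivative_cong_on_open[OF assms] by simp

lemma pd_inner:
  fixes a b :: "real^'m::finite \<Rightarrow> 'b::euclidean_space"
  assumes "a differentiable (at u)" "b differentiable (at u)"
  shows "pd i (\<lambda>w. a w \<bullet> b w) u = pd i a u \<bullet> b u + a u \<bullet> pd i b u"
  unfolding pd_def
  using frechet_derivative_eqI[OF has_derivative_inner[OF has_derivative_frechet[OF assms(1)] has_derivative_frechet[OF assms(2)]]]
  by simp

lemma pd_sum_scaleR:
  fixes b :: "'k::finite \<Rightarrow> real^'m::finite \<Rightarrow> 'b::euclidean_space"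
  assumes "\<And>k. a k differentiable (at u)" "\<And>k. b k differentiable (at u)"
  shows "pd i (\<lambda>w. \<Sum>k\<in>UNIV. a k w *\<^sub>R b k w) u = (\<Sum>k\<in>UNIV. a k u *\<^sub>R pd i (b k) u + pd i (a k) u *\<^sub>R b k u)"
proof -
  have "((\<lambda>w. \<Sum>k\<in>UNIV. a k w *\<^sub>R b k w) has_derivative
     (\<lambda>v. \<Sum>k\<in>UNIV. a k u *\<^sub>R frechet_derivative (b k) (at u) v + frechet_derivative (a k) (at u) v *\<^sub>R b k u)) (at u)"
    by (intro has_derivative_sum has_derivative_scaleR has_derivative_frechet assms)
  then show ?thesis
    unfolding pd_def by (simp add: frechet_derivative_eqI)
qed

lemma induced_metric_nth: "induced_metric \<phi> u $ i $ j = pd i \<phi> u \<bullet> pd j \<phi> u"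
  by (simp add: induced_metric_def)

definition coordinate_frame :: "(real^'m::finite \<Rightarrow> real^'n::finite) \<Rightarrow> real^'m \<Rightarrow> real^'n^'m" where
  "coordinate_frame \<phi> u = (\<chi> i. pd i \<phi> u)"

lemma coordinate_frame_nth [simp]: "coordinate_frame \<phi> u $ i = pd i \<phi> u"
  by (simp add: coordinate_frame_def)

lemma induced_metric_eq_gram:
  "induced_metric \<phi> u = coordinate_frame \<phi> u ** transpose (coordinate_frame \<phi> u)"
  by (simp add: vec_eq_iff induced_metric_nth mult_transpose_nth)

lemma coordinate_combination: "c v* coordinate_frame \<phi> u = (\<Sum>i\<in>UNIV. c $ i *\<^sub>R pd i \<phi> u)"
  by (simp add: vec_eq_iff vector_matrix_mult_def coordinate_frame_def)

lemma frechet_derivative_coordinates: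
  fixes F :: "real^'m::finite \<Rightarrow> 'b::real_normed_vector"
  assumes "F differentiable (at u)"
  shows "frechet_derivative F (at u) v = (\<Sum>i\<in>UNIV. v $ i *\<^sub>R pd i F u)"
proof -
  have lin: "linear (frechet_derivative F (at u))"
    using assms by (rule linear_frechet_derivative)
  have "frechet_derivative F (at u) (\<Sum>i\<in>UNIV. (v $ i) *s axis i 1) = (\<Sum>i\<in>UNIV. v $ i *\<^sub>R pd i F u)"
    by (simp add: linear_sum[OF lin] linear_cmul[OF lin] scalar_mult_eq_scaleR pd_def)
  then show ?thesis by (simp add: basis_expansion)
qed

text \<open>The stress-energy tensor, the curvature and the differential of the Gauss map at a point are all
  computed in one parametrization around it; charts are compared only afterwards.\<close>

locale immersed_chart =
  fixes U :: "(real^'m::finite) set" and \<phi> :: "real^'m \<Rightarrow> real^'n::finite"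
  assumes open_domain: "open U" and smooth: "smooth_on U \<phi>"
    and immersion: "\<And>u. u \<in> U \<Longrightarrow> inj (frechet_derivative \<phi> (at u))"
begin

abbreviation g :: "real^'m \<Rightarrow> real^'m^'m" where "g \<equiv> induced_metric \<phi>"
abbreviation ginv :: "'m \<Rightarrow> 'm \<Rightarrow> real^'m \<Rightarrow> real" where "ginv i j u \<equiv> matrix_inv (g u) $ i $ j"
abbreviation \<Gamma> :: "'m \<Rightarrow> 'm \<Rightarrow> 'm \<Rightarrow> real^'m \<Rightarrow> real" where "\<Gamma> k i j u \<equiv> christoffel g u k i j"
abbreviation II :: "'m \<Rightarrow> 'm \<Rightarrow> real^'m \<Rightarrow> real^'n" where "II i j u \<equiv> hessian_map g \<phi> u i j"
abbreviation \<tau> :: "real^'m \<Rightarrow> real^'n" where "\<tau> \<equiv> tension g \<phi>"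

text \<open>
  Classically the third fundamental form: \<open>T(\<partial>\<^sub>i, \<partial>\<^sub>j) = \<Sum> g\<^sup>k\<^sup>l \<langle>B(\<partial>\<^sub>i, \<partial>\<^sub>k), B(\<partial>\<^sub>j, \<partial>\<^sub>l)\<rangle>\<close>.
\<close>

definition third_form :: "real^'m \<Rightarrow> 'm \<Rightarrow> 'm \<Rightarrow> real" where
  "third_form u i j = (\<Sum>k\<in>UNIV. \<Sum>l\<in>UNIV. ginv k l u * (II i k u \<bullet> II j l u))"

lemma differential: "u \<in> U \<Longrightarrow> frechet_derivative \<phi> (at u) v = v v* coordinate_frame \<phi> u"
  using frechet_derivative_coordinates[OF smooth_on_imp_differentiable[OF smooth]]
  by (simp add: coordinate_combination)

lemma inj_frame: "u \<in> U \<Longrightarrow> inj (\<lambda>v. v v* coordinate_frame \<phi> u)"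
  using immersion[of u] by (simp add: inj_def differential)

lemma det_metric: "u \<in> U \<Longrightarrow> det (g u) \<noteq> 0"
  by (simp add: induced_metric_eq_gram gram_det_nonzero inj_frame)

lemma metric_diag_pos:
  assumes "u \<in> U"
  shows "g u $ i $ i > 0"
proof -
  have "frechet_derivative \<phi> (at u) (axis i 1) \<noteq> frechet_derivative \<phi> (at u) 0"
    using immersion[OF assms] by (simp add: inj_eq)
  then have "pd i \<phi> u \<noteq> 0"
    using linear_0[OF linear_frechet_derivative[OF smooth_on_imp_differentiable[OF smooth assms]]]
    by (simp add: pd_def)
  then show ?thesis by (simp add: induced_metric_nth)
qed

lemma ginv_g: "u \<in> U \<Longrightarrow> (\<Sum>k\<in>UNIV. ginv i k u * (pd k \<phi> u \<bullet> pd j \<phi> u)) = (if i = j then 1 else 0)"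
  using invertible_right_inverse_inv(2)[OF det_metric, of u]
  by (simp add: vec_eq_iff matrix_matrix_mult_def mat_def induced_metric_nth)

lemma ginv_sym:
  assumes "u \<in> U"
  shows "ginv i j u = ginv j i u"
proof -
  let ?A = "matrix_inv (g u)"
  have sym: "transpose (g u) = g u"
    by (simp add: vec_eq_iff transpose_def induced_metric_nth inner_commute)
  have "transpose (g u ** ?A) = mat 1"
    by (simp add: invertible_right_inverse_inv det_metric assms)
  then have "transpose ?A ** g u = mat 1"
    by (simp add: matrix_transpose_mul sym)
  then have "transpose ?A = ?A"
    using invertible_right_inverse_inv(1)[OF det_metric[OF assms]]
    by (metis matrix_mul_assoc matrix_mul_lid matrix_mul_rid)
  moreover have "transpose ?A $ j $ i = ?A $ i $ j" by (simp add: transpose_def)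
  ultimately show ?thesis by simp
qed

lemma smooth_pd: "smooth_on U (pd i \<phi>)"
  by (rule smooth_on_pd[OF smooth])

lemma smooth_metric: "smooth_on U (\<lambda>u. g u $ i $ j)"
  unfolding induced_metric_nth by (intro smooth_on_inner open_domain smooth_pd)

lemma smooth_ginv: "smooth_on U (ginv i j)"
  by (rule smooth_on_matrix_inv[OF open_domain smooth_metric det_metric])

lemmas diff_pd = smooth_on_imp_differentiable[OF smooth_pd]
lemmas diff_pd2 = smooth_on_imp_differentiable[OF smooth_on_pd[OF smooth_pd]]

lemma pd2_commute: "u \<in> U \<Longrightarrow> pd i (pd j \<phi>) u = pd j (pd i \<phi>) u"
  by (rule pd_commute[OF open_domain _ smooth])

text \<open>The Christoffel symbols of an induced metric are the tangential components of the second
  derivatives: expanding the derivatives of \<open>g\<close>, all terms but one pair cancel by symmetry.\<close>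

lemma christoffel_eq:
  assumes u: "u \<in> U"
  shows "\<Gamma> k i j u = (\<Sum>l\<in>UNIV. ginv k l u * (pd l \<phi> u \<bullet> pd i (pd j \<phi>) u))"
proof -
  have "pd i (\<lambda>w. g w $ j $ l) u = pd i (pd j \<phi>) u \<bullet> pd l \<phi> u + pd j \<phi> u \<bullet> pd i (pd l \<phi>) u" for i j l
    unfolding induced_metric_nth by (rule pd_inner[OF diff_pd diff_pd, OF u u])
  then have "pd i (\<lambda>w. g w $ j $ l) u + pd j (\<lambda>w. g w $ i $ l) u - pd l (\<lambda>w. g w $ i $ j) u
      = 2 * (pd l \<phi> u \<bullet> pd i (pd j \<phi>) u)" for l
    using pd2_commute[OF u, of i j] pd2_commute[OF u, of i l] pd2_commute[OF u, of j l]
    by (simp add: inner_commute)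
  then show ?thesis
    by (simp add: christoffel_def sum_distrib_left)
qed

lemma christoffel_sym: "u \<in> U \<Longrightarrow> \<Gamma> k i j u = \<Gamma> k j i u"
  by (simp add: christoffel_eq pd2_commute[of u i j])

lemma gauss_formula: "pd i (pd j \<phi>) u = II i j u + (\<Sum>k\<in>UNIV. \<Gamma> k i j u *\<^sub>R pd k \<phi> u)"
  by (simp add: hessian_map_def)

lemma II_sym: "u \<in> U \<Longrightarrow> II i j u = II j i u"
  by (simp add: hessian_map_def pd2_commute[of u i j] christoffel_sym[of u _ i j])

text \<open>By \<open>christoffel_eq\<close>, the Christoffel terms subtract exactly the tangential part of the
  second derivative.\<close>

lemma II_normal:
  assumes u: "u \<in> U"
  shows "pd l \<phi> u \<bullet> II i j u = 0"
proof -
  have "pd l \<phi> u \<bullet> (\<Sum>k\<in>UNIV. \<Gamma> k i j u *\<^sub>R pd k \<phi> u) =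
      (\<Sum>k\<in>UNIV. \<Sum>m\<in>UNIV. (ginv m k u * (pd k \<phi> u \<bullet> pd l \<phi> u)) * (pd m \<phi> u \<bullet> pd i (pd j \<phi>) u))"
    by (simp add: inner_sum_right christoffel_eq[OF u] sum_distrib_left ginv_sym[OF u]
        inner_commute[of "pd l \<phi> u"] mult_ac)
  also have "\<dots> = (\<Sum>m\<in>UNIV. (\<Sum>k\<in>UNIV. ginv m k u * (pd k \<phi> u \<bullet> pd l \<phi> u)) * (pd m \<phi> u \<bullet> pd i (pd j \<phi>) u))"
    by (subst sum.swap) (simp add: sum_distrib_right)
  also have "\<dots> = pd l \<phi> u \<bullet> pd i (pd j \<phi>) u"
    by (simp add: ginv_g[OF u] if_distrib[of "\<lambda>x. x * _"] cong: if_cong)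
  finally show ?thesis
    by (simp add: gauss_formula inner_add_right)
qed

lemma smooth_christoffel: "smooth_on U (\<Gamma> k i j)"
proof -
  have "smooth_on U (\<lambda>u. \<Sum>l\<in>UNIV. ginv k l u * (pd l \<phi> u \<bullet> pd i (pd j \<phi>) u))"
    by (intro smooth_on_sum smooth_on_mult smooth_on_inner open_domain smooth_ginv smooth_pd smooth_on_pd)
  then show ?thesis
    by (rule smooth_on_cong[OF open_domain]) (simp add: christoffel_eq)
qed

lemma smooth_II: "smooth_on U (II i j)"
  unfolding hessian_map_def
  by (intro smooth_on_diff smooth_on_sum smooth_on_scaleR open_domain smooth_christoffel smooth_pd smooth_on_pd)

lemma smooth_tension: "smooth_on U \<tau>"
  unfolding tension_def[abs_def]
  by (intro smooth_on_sum smooth_on_scaleR open_domain smooth_ginv smooth_II)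

lemma tension_normal: "u \<in> U \<Longrightarrow> pd l \<phi> u \<bullet> \<tau> u = 0"
  by (simp add: tension_def inner_sum_right II_normal)

lemma inner_normal_hessian:
  assumes "\<And>l. pd l \<phi> u \<bullet> n = 0"
  shows "pd i (pd j \<phi>) u \<bullet> n = II i j u \<bullet> n"
  unfolding gauss_formula by (simp add: inner_add_left inner_sum_left assms)

text \<open>Differentiation of \<open>\<langle>\<partial>\<^sub>i \<phi>, \<tau>\<rangle> = 0\<close>.\<close>

lemma weingarten_tension:
  assumes u: "u \<in> U"
  shows "pd i \<phi> u \<bullet> pd j \<tau> u = - (II i j u \<bullet> \<tau> u)"
proof -
  have "pd j (\<lambda>w. pd i \<phi> w \<bullet> \<tau> w) u = pd j (\<lambda>w. 0) u"
    by (rule pd_cong_on_open[OF open_domain u]) (simp add: tension_normal)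
  also have "\<dots> = 0" by (simp add: pd_def)
  finally have "pd j (pd i \<phi>) u \<bullet> \<tau> u + pd i \<phi> u \<bullet> pd j \<tau> u = 0"
    using pd_inner[OF diff_pd[OF u] smooth_on_imp_differentiable[OF smooth_tension u], of j i] by simp
  then show ?thesis
    using inner_normal_hessian[OF tension_normal[OF u], of j i] II_sym[OF u, of i j] by simp
qed

lemma trace_II: "(\<Sum>i\<in>UNIV. \<Sum>j\<in>UNIV. ginv i j u * (II i j u \<bullet> n)) = \<tau> u \<bullet> n"
  by (simp add: tension_def inner_sum_left)

text \<open>Tracing \<open>\<langle>\<partial>\<^sub>i \<phi>, \<partial>\<^sub>j \<tau>\<rangle> = - \<langle>B\<^sub>i\<^sub>j, \<tau>\<rangle>\<close> gives \<open>\<langle>d\<phi>, \<nabla>\<tau>\<rangle> = - |\<tau>|\<^sup>2\<close>.\<close>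

lemma stress_energy2_eq:
  assumes u: "u \<in> U"
  shows "stress_energy2 g \<phi> u $ i $ j = 2 * (II i j u \<bullet> \<tau> u) - 1/2 * (norm (\<tau> u))\<^sup>2 * g u $ i $ j"
proof -
  have "dphi_nabla_tension g \<phi> u = - (norm (\<tau> u))\<^sup>2"
    unfolding dphi_nabla_tension_def weingarten_tension[OF u]
    by (simp add: sum_negf trace_II power2_norm_eq_inner)
  then show ?thesis
    using II_sym[OF u, of i j]
    by (simp add: stress_energy2_def weingarten_tension[OF u] algebra_simps)
qed

text \<open>The core of the Gauss equation.  With the dual frame \<open>E\<^sup>l = \<Sum> g\<^sup>l\<^sup>m \<partial>\<^sub>m \<phi>\<close> one has
  \<open>\<Gamma>\<^sup>l\<^sub>j\<^sub>k = \<langle>E\<^sup>l, \<partial>\<^sub>j \<partial>\<^sub>k \<phi>\<rangle>\<close>.  In the derivative of this product, \<open>\<partial>\<^sub>i E\<^sup>l\<close> has tangential components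
  \<open>- \<Gamma>\<^sup>l\<^sub>i\<^sub>p\<close>, since \<open>\<langle>E\<^sup>l, \<partial>\<^sub>p \<phi>\<rangle>\<close> is constant, and normal part \<open>\<Sum> g\<^sup>l\<^sup>m B\<^sub>i\<^sub>m\<close>.  The term with third
  derivatives is symmetric in \<open>i\<close> and \<open>j\<close> and so drops out of the curvature.\<close>

lemma pd_christoffel:
  assumes u: "u \<in> U"
  shows "pd i (\<Gamma> l j k) u + (\<Sum>p\<in>UNIV. \<Gamma> l i p u * \<Gamma> p j k u) =
    (\<Sum>m\<in>UNIV. ginv l m u *\<^sub>R pd m \<phi> u) \<bullet> pd i (pd j (pd k \<phi>)) u +
    (\<Sum>m\<in>UNIV. ginv l m u * (II i m u \<bullet> II j k u))"
proof -
  define E where "E = (\<lambda>w. \<Sum>m\<in>UNIV. ginv l m w *\<^sub>R pd m \<phi> w)"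
  have smE: "smooth_on U E"
    unfolding E_def by (intro smooth_on_sum smooth_on_scaleR open_domain smooth_ginv smooth_pd)
  note dE = smooth_on_imp_differentiable[OF smE u]
  have E_pd: "E w \<bullet> pd p \<phi> w = (if l = p then 1 else 0)" if "w \<in> U" for w p
    by (simp add: E_def inner_sum_left ginv_g[OF that])
  have \<Gamma>_E: "\<Gamma> l i j w = E w \<bullet> pd i (pd j \<phi>) w" if "w \<in> U" for w i j
    by (simp add: E_def inner_sum_left christoffel_eq[OF that])
  have "pd i (\<lambda>w. E w \<bullet> pd p \<phi> w) u = pd i (\<lambda>w. if l = p then 1 else 0) u" for p
    by (rule pd_cong_on_open[OF open_domain u E_pd])
  then have dE_tangent: "pd i E u \<bullet> pd p \<phi> u = - \<Gamma> l i p u" for p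
    using pd_inner[OF dE diff_pd[OF u], of i p] by (simp add: \<Gamma>_E[OF u] pd_def)
  have "pd i E u = (\<Sum>m\<in>UNIV. ginv l m u *\<^sub>R pd i (pd m \<phi>) u + pd i (ginv l m) u *\<^sub>R pd m \<phi> u)"
    unfolding E_def by (rule pd_sum_scaleR[OF smooth_on_imp_differentiable[OF smooth_ginv u] diff_pd[OF u]])
  then have dE_normal: "pd i E u \<bullet> II j k u = (\<Sum>m\<in>UNIV. ginv l m u * (II i m u \<bullet> II j k u))"
    by (simp add: inner_sum_left inner_add_left II_normal[OF u] inner_normal_hessian[OF II_normal[OF u]])
  have "pd i (\<Gamma> l j k) u = pd i (\<lambda>w. E w \<bullet> pd j (pd k \<phi>) w) u"
    by (rule pd_cong_on_open[OF open_domain u \<Gamma>_E])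
  also have "\<dots> = pd i E u \<bullet> pd j (pd k \<phi>) u + E u \<bullet> pd i (pd j (pd k \<phi>)) u"
    by (rule pd_inner[OF dE diff_pd2[OF u]])
  also have "pd i E u \<bullet> pd j (pd k \<phi>) u =
      pd i E u \<bullet> II j k u - (\<Sum>p\<in>UNIV. \<Gamma> l i p u * \<Gamma> p j k u)"
    unfolding gauss_formula[of j k]
    by (simp add: inner_add_right inner_sum_right dE_tangent sum_negf mult.commute)
  finally show ?thesis
    by (simp add: dE_normal) (simp add: E_def)
qed

lemma riemann_eq:
  assumes u: "u \<in> U"
  shows "riemann g u l i j k =
    (\<Sum>m\<in>UNIV. ginv l m u * (II i m u \<bullet> II j k u - II j m u \<bullet> II i k u))"
proof -
  have "pd i (pd j (pd k \<phi>)) u = pd j (pd i (pd k \<phi>)) u"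
    by (rule pd_commute[OF open_domain u smooth_pd])
  then show ?thesis
    using pd_christoffel[OF u, of i l j k] pd_christoffel[OF u, of j l i k]
    by (simp add: riemann_def sum_subtractf right_diff_distrib)
qed

text \<open>The contracted Gauss equation.\<close>

lemma ricci_eq:
  assumes u: "u \<in> U"
  shows "ricci g u $ j $ k = II j k u \<bullet> \<tau> u - third_form u j k"
proof -
  have "(\<Sum>i\<in>UNIV. \<Sum>m\<in>UNIV. ginv i m u * (II j m u \<bullet> II i k u)) = third_form u j k"
    unfolding third_form_def
    by (subst sum.swap) (simp add: ginv_sym[OF u] II_sym[OF u, of _ k])
  then show ?thesis
    by (simp add: ricci_def riemann_eq[OF u] right_diff_distrib sum_subtractf trace_II inner_commute)
qed

end

section \<open>The differential of the Gauss map\<close>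

context immersed_chart
begin

lemma trace_orthonormal_frame:
  fixes L :: "real^'m^'m" and \<beta> :: "'m \<Rightarrow> 'm \<Rightarrow> 'b::real_vector"
  assumes "orthonormal_frame (L ** coordinate_frame \<phi> u)"
  shows "(\<Sum>a\<in>UNIV. \<Sum>i\<in>UNIV. \<Sum>k\<in>UNIV. (L $ a $ i * L $ a $ k) *\<^sub>R \<beta> i k) =
    (\<Sum>i\<in>UNIV. \<Sum>k\<in>UNIV. ginv i k u *\<^sub>R \<beta> i k)"
proof -
  have ginv: "(\<Sum>a\<in>UNIV. L $ a $ i * L $ a $ k) = ginv i k u" for i k
    unfolding induced_metric_eq_gram orthonormal_change_of_frame(2)[OF assms, symmetric]
    by (simp add: matrix_matrix_mult_def transpose_def)
  have "(\<Sum>a\<in>UNIV. \<Sum>i\<in>UNIV. \<Sum>k\<in>UNIV. (L $ a $ i * L $ a $ k) *\<^sub>R \<beta> i k) =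
    (\<Sum>i\<in>UNIV. \<Sum>k\<in>UNIV. (\<Sum>a\<in>UNIV. L $ a $ i * L $ a $ k) *\<^sub>R \<beta> i k)"
    by (subst sum.swap, rule sum.cong[OF refl], subst sum.swap) (simp add: scaleR_sum_left)
  then show ?thesis by (simp only: ginv)
qed

lemma frame_has_derivative:
  assumes u: "u \<in> U"
  shows "(coordinate_frame \<phi> has_derivative (\<lambda>v. \<chi> i. frechet_derivative (pd i \<phi>) (at u) v)) (at u)"
proof -
  have "((\<lambda>w. coordinate_frame \<phi> w $ i $ j) has_derivative
      (\<lambda>v. (\<chi> i. frechet_derivative (pd i \<phi>) (at u) v) $ i $ j)) (at u)" for i j
    using bounded_linear.has_derivative[OF bounded_linear_vec_nth has_derivative_frechet[OF diff_pd[OF u]]] by simp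
  then show ?thesis
    unfolding has_derivative_componentwise_within[of "coordinate_frame \<phi>"]
    by (auto simp: Basis_vec_def inner_axis)
qed

text \<open>The differential of the Gauss map is the second fundamental form: by
  \<open>grass_chart_has_derivative\<close>, in the direction \<open>\<partial>\<^sub>i\<close> it sends \<open>\<partial>\<^sub>k \<phi>\<close> to the normal part
  of \<open>\<partial>\<^sub>i \<partial>\<^sub>k \<phi>\<close>.  The map \<open>G\<close> is left abstract because the Gauss map depends on the whole atlas.\<close>

lemma gauss_differential:
  assumes u: "u \<in> U" and G: "\<forall>w\<in>U. G (\<phi> w) = oplane (coordinate_frame \<phi> w)"
  shows "((\<lambda>w. grass_chart (G (\<phi> u)) (G (\<phi> w))) has_derivative grass_differential (G \<circ> \<phi>) u) (at u)"
    and "grass_differential (G \<circ> \<phi>) u v *v (c v* coordinate_frame \<phi> u) =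
      (\<Sum>i\<in>UNIV. \<Sum>k\<in>UNIV. (v $ i * c $ k) *\<^sub>R II i k u)"
proof -
  let ?Y = "coordinate_frame \<phi>"
  let ?Y' = "\<lambda>v. \<chi> i. frechet_derivative (pd i \<phi>) (at u) v"
  obtain X where X: "X \<in> oplane (?Y u)"
    using oplane_nonempty[OF inj_frame[OF u]] by blast
  then obtain L where L: "X = L ** ?Y u" and "orthonormal_frame X"
    unfolding oplane_def same_orientation_def by blast
  then have XX: "X ** transpose X = mat 1"
    by (simp add: orthonormal_frame_iff)
  from grass_chart_has_derivative[OF frame_has_derivative[OF u] X open_domain u inj_frame]
  obtain D where D: "((\<lambda>w. grass_chart (oplane (?Y u)) (oplane (?Y w))) has_derivative D) (at u)"
    "\<And>v c. D v *v (c v* ?Y u) = c v* (?Y' v - ?Y' v ** transpose X ** X)"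
    by blast
  have D': "((\<lambda>w. grass_chart (G (\<phi> u)) (G (\<phi> w))) has_derivative D) (at u)"
    by (rule has_derivative_transform_within_open[OF D(1) open_domain u]) (simp add: G u)
  then have eq: "grass_differential (G \<circ> \<phi>) u = D"
    by (auto simp: grass_differential_def fun_eq_iff frechet_derivative_eqI)
  show "((\<lambda>w. grass_chart (G (\<phi> u)) (G (\<phi> w))) has_derivative grass_differential (G \<circ> \<phi>) u) (at u)"
    using D' by (simp add: eq)
  define nor where "nor y = y - (X *v y) v* X" for y
  have lin: "linear nor"
    unfolding nor_def
    by (intro linearI) (simp_all add: algebra_simps matrix_vector_right_distrib vector_matrix_left_distrib
        scaleR_vector_matrix_assoc matrix_vector_mult_scaleR)
  have nor_II: "nor (II i k u) = II i k u" for i k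
  proof -
    have "?Y u *v II i k u = 0"
      by (simp add: vec_eq_iff matrix_vector_mul_component II_normal[OF u])
    then show ?thesis
      by (simp add: nor_def L flip: matrix_vector_mul_assoc)
  qed
  have nor_tangent: "nor (pd p \<phi> u) = 0" for p
  proof -
    have "pd p \<phi> u = frechet_derivative \<phi> (at u) (axis p 1)" by (simp add: pd_def)
    then have "pd p \<phi> u \<in> range (\<lambda>v. v v* ?Y u)"
      by (simp add: differential[OF u])
    also have "\<dots> = range (\<lambda>v. v v* X)"
      using plane_of_oplane[OF X] by simp
    finally obtain c where "pd p \<phi> u = c v* X" by blast
    moreover have "X *v (c v* X) = c"
    proof -
      have "X *v (c v* X) = (X ** transpose X) *v c"
        by (simp flip: matrix_vector_mul_assoc)
      then show ?thesis by (simp add: XX)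
    qed
    ultimately show ?thesis by (simp add: nor_def)
  qed
  have nor_hessian: "nor (pd i (pd k \<phi>) u) = II i k u" for i k
    unfolding gauss_formula
    by (simp add: linear_add[OF lin] linear_sum[OF lin] linear_cmul[OF lin] nor_II nor_tangent)
  have rows: "c v* M = (\<Sum>k\<in>UNIV. c $ k *\<^sub>R M $ k)" for M :: "real^'n^'m"
    by (simp add: vec_eq_iff vector_matrix_mult_def)
  have "(?Y' v - ?Y' v ** transpose X ** X) $ k = nor (?Y' v $ k)" for k
    by (simp add: nor_def row_mult)
  also have "\<dots> k = (\<Sum>i\<in>UNIV. v $ i *\<^sub>R II i k u)" for k
    by (simp add: frechet_derivative_coordinates[OF diff_pd[OF u]] linear_sum[OF lin] linear_cmul[OF lin] nor_hessian)
  finally have "D v *v (c v* ?Y u) = (\<Sum>k\<in>UNIV. c $ k *\<^sub>R (\<Sum>i\<in>UNIV. v $ i *\<^sub>R II i k u))"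
    unfolding D(2) rows[of "?Y' v - ?Y' v ** transpose X ** X"] by simp
  also have "\<dots> = (\<Sum>i\<in>UNIV. \<Sum>k\<in>UNIV. (v $ i * c $ k) *\<^sub>R II i k u)"
    by (simp add: scaleR_sum_right mult.commute, rule sum.swap)
  finally show "grass_differential (G \<circ> \<phi>) u v *v (c v* ?Y u) = \<dots>"
    by (simp add: eq)
qed

lemma gauss_differential_coordinates:
  assumes u: "u \<in> U" and G: "\<forall>w\<in>U. G (\<phi> w) = oplane (coordinate_frame \<phi> w)"
  shows "grass_differential (G \<circ> \<phi>) u (axis i 1) *v (c v* coordinate_frame \<phi> u) =
      (\<Sum>k\<in>UNIV. c $ k *\<^sub>R II i k u)"
    and "grass_differential (G \<circ> \<phi>) u (axis i 1) *v pd k \<phi> u = II i k u"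
proof -
  show *: "grass_differential (G \<circ> \<phi>) u (axis i 1) *v (c v* coordinate_frame \<phi> u) =
      (\<Sum>k\<in>UNIV. c $ k *\<^sub>R II i k u)" for c
  proof -
    have "(\<Sum>i'\<in>UNIV. \<Sum>k\<in>UNIV. (axis i 1 $ i' * c $ k) *\<^sub>R II i' k u) =
      (\<Sum>i'\<in>UNIV. if i' = i then \<Sum>k\<in>UNIV. c $ k *\<^sub>R II i k u else 0)"
      by (intro sum.cong refl) (auto simp: axis_def)
    then show ?thesis
      by (simp add: gauss_differential(2)[OF u G])
  qed
  have "pd k \<phi> u = axis k 1 v* coordinate_frame \<phi> u"
    by (simp add: pd_def flip: differential[OF u])
  moreover have "(\<Sum>k'\<in>UNIV. axis k 1 $ k' *\<^sub>R II i k' u) = (\<Sum>k'\<in>UNIV. if k' = k then II i k u else 0)"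
    by (intro sum.cong refl) (auto simp: axis_def)
  ultimately show "grass_differential (G \<circ> \<phi>) u (axis i 1) *v pd k \<phi> u = II i k u"
    by (simp add: *)
qed

lemma grass_metric_gauss_differential:
  assumes u: "u \<in> U" and G: "\<forall>w\<in>U. G (\<phi> w) = oplane (coordinate_frame \<phi> w)"
  shows "grass_metric (G (\<phi> u)) (grass_differential (G \<circ> \<phi>) u (axis i 1))
      (grass_differential (G \<circ> \<phi>) u (axis j 1)) = third_form u i j"
proof -
  obtain X where X: "X \<in> oplane (coordinate_frame \<phi> u)"
    using oplane_nonempty[OF inj_frame[OF u]] by blast
  have "grass_differential (G \<circ> \<phi>) u (axis i 1) *v (c v* coordinate_frame \<phi> u)
      \<in> orthogonal_comp (plane_of (oplane (coordinate_frame \<phi> u)))" for c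
  proof -
    have "pd l \<phi> u \<bullet> (grass_differential (G \<circ> \<phi>) u (axis i 1) *v (c v* coordinate_frame \<phi> u)) = 0" for l
      unfolding gauss_differential_coordinates(1)[OF u G] by (simp add: inner_sum_right II_normal[OF u])
    moreover have "(b v* coordinate_frame \<phi> u) \<bullet> y = (\<Sum>l\<in>UNIV. b $ l * (pd l \<phi> u \<bullet> y))" for b y
      by (simp add: coordinate_combination inner_sum_left)
    ultimately show ?thesis
      unfolding orthogonal_comp_def plane_of_oplane(2)[OF X]
      by (auto simp: orthogonal_def)
  qed
  from grass_metric_eq[OF inj_frame[OF u] this]
  show ?thesis
    by (simp add: bspec[OF G u] gauss_differential_coordinates(2)[OF u G] third_form_def induced_metric_eq_gram)
qed

text \<open>This formula for \<open>\<tau>\<close> uses only first derivatives of \<open>\<phi>\<close> and of \<open>G \<circ> \<phi>\<close>, so that its behaviour under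
  a change of chart follows from the ordinary chain rule.\<close>

lemma tension_eq_frame_trace:
  fixes X :: "real^'n^'m"
  assumes u: "u \<in> U" and G: "\<forall>w\<in>U. G (\<phi> w) = oplane (coordinate_frame \<phi> w)"
    and X: "orthonormal_frame X" "\<And>a. X $ a = frechet_derivative \<phi> (at u) (v a)"
  shows "\<tau> u = (\<Sum>a\<in>UNIV. grass_differential (G \<circ> \<phi>) u (v a) *v (X $ a))"
proof -
  define L where "L = (\<chi> a. v a)"
  have "X = L ** coordinate_frame \<phi> u"
    by (simp add: vec_eq_iff[of X] row_mult L_def X(2) differential[OF u])
  then have "orthonormal_frame (L ** coordinate_frame \<phi> u)" using X(1) by simp
  from trace_orthonormal_frame[OF this, of "\<lambda>i k. II i k u"]
  show ?thesis
    by (simp add: tension_def X(2) differential[OF u] gauss_differential(2)[OF u G] L_def)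
qed

end

section \<open>Change of charts\<close>

lemma oriented_submanifoldD:
  assumes "oriented_submanifold M A"
  shows "\<forall>c\<in>A. local_param c" and "M = (\<Union>(U, \<phi>)\<in>A. \<phi> ` U)"
    and "\<forall>c\<in>A. \<forall>d\<in>A. open (overlap c d) \<and> smooth_on (overlap c d) (transition c d) \<and>
        (\<forall>u\<in>overlap c d. det (matrix (frechet_derivative (transition c d) (at u))) > 0)"
proof -
  note D = assms[unfolded oriented_submanifold_def]
  show "\<forall>c\<in>A. local_param c" by (rule D[THEN conjunct1])
  show "M = (\<Union>(U, \<phi>)\<in>A. \<phi> ` U)" by (rule D[THEN conjunct2, THEN conjunct1])
  show "\<forall>c\<in>A. \<forall>d\<in>A. open (overlap c d) \<and> smooth_on (overlap c d) (transition c d) \<and>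
        (\<forall>u\<in>overlap c d. det (matrix (frechet_derivative (transition c d) (at u))) > 0)"
    by (rule D[THEN conjunct2, THEN conjunct2, THEN conjunct2])
qed

lemma oriented_submanifold_chart:
  assumes "oriented_submanifold M A" "(U, \<phi>) \<in> A"
  shows "immersed_chart U \<phi>"
proof -
  have "local_param (U, \<phi>)"
    using oriented_submanifoldD(1)[OF assms(1)] assms(2) by (rule bspec)
  then show ?thesis
    by (simp add: local_param_def immersed_chart_def)
qed

lemma oriented_submanifold_mem:
  assumes "oriented_submanifold M A"
  shows "q \<in> M \<longleftrightarrow> (\<exists>(U, \<phi>)\<in>A. \<exists>u\<in>U. \<phi> u = q)"
  unfolding oriented_submanifoldD(2)[OF assms] by auto

lemma chart_transition:
  assumes M: "oriented_submanifold M A" and c: "(U, \<phi>) \<in> A" and d: "(V, \<psi>) \<in> A"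
    and u: "u \<in> U" and v: "v \<in> V" and uv: "\<phi> u = \<psi> v"
  obtains W T where "open W" "u \<in> W" "W \<subseteq> U" "T u = v" "T ` W \<subseteq> V"
    "\<And>w. w \<in> W \<Longrightarrow> \<phi> w = \<psi> (T w)" "T differentiable (at u)"
    "det (matrix (frechet_derivative T (at u))) > 0"
proof
  let ?W = "overlap (U, \<phi>) (V, \<psi>)" and ?T = "transition (U, \<phi>) (V, \<psi>)"
  have W: "w \<in> ?W \<longleftrightarrow> w \<in> U \<and> \<phi> w \<in> \<psi> ` V" for w
    by (simp add: overlap_def)
  have T: "?T w = inv_into V \<psi> (\<phi> w)" for w
    by (simp add: transition_def)
  have "local_param (V, \<psi>)"
    using oriented_submanifoldD(1)[OF M] d by (rule bspec)
  then have inj: "inj_on \<psi> V"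
    by (simp add: local_param_def)
  have *: "open ?W" "smooth_on ?W ?T" "\<forall>u\<in>?W. det (matrix (frechet_derivative ?T (at u))) > 0"
    using bspec[OF bspec[OF oriented_submanifoldD(3)[OF M] c] d] by simp_all
  show "open ?W" by fact
  show uW: "u \<in> ?W" using u v uv by (simp add: W)
  show "?W \<subseteq> U" by (auto simp: W)
  show "?T u = v" using inj v by (simp add: T uv)
  show "?T ` ?W \<subseteq> V" by (auto simp: W T inv_into_into)
  show "\<phi> w = \<psi> (?T w)" if "w \<in> ?W" for w
    using that by (simp add: W T f_inv_into_f)
  show "?T differentiable (at u)" by (rule smooth_on_imp_differentiable[OF *(2) uW])
  show "det (matrix (frechet_derivative ?T (at u))) > 0" using *(3) uW by blast
qed

lemma frechet_derivative_chain_on_open: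
  assumes "open W" "u \<in> W" "\<And>w. w \<in> W \<Longrightarrow> F w = H (T w)"
    and T: "T differentiable (at u)" and H: "(H has_derivative H') (at (T u))"
  shows "(F has_derivative (\<lambda>x. H' (frechet_derivative T (at u) x))) (at u)"
  using has_derivative_transform_within_open[OF diff_chain_at[OF has_derivative_frechet[OF T] H] assms(1,2)]
    assms(3) by (simp add: o_def)

text \<open>The two coordinate frames at a point differ by the transposed Jacobian matrix of the transition
  map, whose determinant is positive.\<close>

lemma coordinate_frame_transition:
  assumes M: "oriented_submanifold M A" and c: "(U, \<phi>) \<in> A" and d: "(V, \<psi>) \<in> A"
    and u: "u \<in> U" and v: "v \<in> V" and uv: "\<phi> u = \<psi> v"
  shows "same_orientation (coordinate_frame \<phi> u) (coordinate_frame \<psi> v)"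
proof -
  interpret c: immersed_chart U \<phi> by (rule oriented_submanifold_chart[OF M c])
  interpret d: immersed_chart V \<psi> by (rule oriented_submanifold_chart[OF M d])
  obtain W T where T: "open W" "u \<in> W" "T u = v" "\<And>w. w \<in> W \<Longrightarrow> \<phi> w = \<psi> (T w)"
    "T differentiable (at u)" and det: "det (matrix (frechet_derivative T (at u))) > 0"
    using chart_transition[OF assms] by metis
  let ?J = "frechet_derivative T (at u)"
  have d\<psi>: "(\<psi> has_derivative frechet_derivative \<psi> (at (T u))) (at (T u))"
    using smooth_on_imp_differentiable[OF d.smooth v] T(3) by (simp add: has_derivative_frechet)
  have "pd i \<phi> u = ?J (axis i 1) v* coordinate_frame \<psi> v" for i
    using frechet_derivative_eqI[OF frechet_derivative_chain_on_open[OF T(1,2,4,5) d\<psi>]]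
    by (simp add: pd_def T(3) d.differential[OF v])
  then have "coordinate_frame \<phi> u = transpose (matrix ?J) ** coordinate_frame \<psi> v"
    by (simp add: vec_eq_iff[of "coordinate_frame \<phi> u"] row_mult) (simp add: transpose_def matrix_def)
  then show ?thesis
    using det unfolding same_orientation_def by (metis det_transpose)
qed

text \<open>The frame chosen in the definition of the Gauss map may be oriented by a different chart; this
  does not matter, as all coordinate frames at a point have the same orientation.\<close>

lemma gauss_map_eq:
  assumes M: "oriented_submanifold M A" and c: "(U, \<phi>) \<in> A" and u: "u \<in> U"
  shows "gauss_map A (\<phi> u) = oplane (coordinate_frame \<phi> u)"
proof -
  interpret c: immersed_chart U \<phi> by (rule oriented_submanifold_chart[OF M c])
  obtain X0 where "X0 \<in> oplane (coordinate_frame \<phi> u)"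
    using oplane_nonempty[OF c.inj_frame[OF u]] by blast
  then have "pos_orthonormal_basis A (\<phi> u) X0"
    using c u by (auto simp: pos_orthonormal_basis_def oplane_def coordinate_frame_def intro!: bexI[of _ "(U, \<phi>)"])
  let ?X = "SOME X. pos_orthonormal_basis A (\<phi> u) X"
  have "pos_orthonormal_basis A (\<phi> u) ?X"
    using \<open>pos_orthonormal_basis A (\<phi> u) X0\<close> by (rule someI)
  then obtain V \<psi> v where d: "(V, \<psi>) \<in> A" "v \<in> V" "\<psi> v = \<phi> u" "same_orientation ?X (coordinate_frame \<psi> v)"
    unfolding pos_orthonormal_basis_def coordinate_frame_def by auto
  then have "same_orientation ?X (coordinate_frame \<phi> u)"
    using coordinate_frame_transition[OF M d(1) c d(2) u d(3)] same_orientation_trans by blast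
  then show ?thesis
    unfolding gauss_map_def by (rule oplane_cong)
qed

text \<open>An orthonormal frame of the tangent space is the image of vectors in either coordinate domain,
  and these correspond under the Jacobian of the transition map.  By the chain rule so do the
  differentials of the Gauss map, and \<open>tension_eq_frame_trace\<close> gives the same sum in both charts.\<close>

lemma tension_well_defined:
  fixes A :: "('m::finite, 'n::finite) param set"
  assumes M: "oriented_submanifold M A" and c: "(U, \<phi>) \<in> A" and d: "(V, \<psi>) \<in> A"
    and u: "u \<in> U" and v: "v \<in> V" and uv: "\<phi> u = \<psi> v"
  shows "tension (induced_metric \<phi>) \<phi> u = tension (induced_metric \<psi>) \<psi> v"
proof -
  interpret c: immersed_chart U \<phi> by (rule oriented_submanifold_chart[OF M c])
  interpret d: immersed_chart V \<psi> by (rule oriented_submanifold_chart[OF M d])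
  let ?G = "gauss_map A"
  have G: "\<forall>w\<in>U. ?G (\<phi> w) = oplane (coordinate_frame \<phi> w)" "\<forall>w\<in>V. ?G (\<psi> w) = oplane (coordinate_frame \<psi> w)"
    using gauss_map_eq[OF M c] gauss_map_eq[OF M d] by blast+
  obtain W T where T: "open W" "u \<in> W" "T u = v" "\<And>w. w \<in> W \<Longrightarrow> \<phi> w = \<psi> (T w)"
    "T differentiable (at u)"
    using chart_transition[OF assms] by metis
  let ?J = "frechet_derivative T (at u)"
  have "(\<psi> has_derivative frechet_derivative \<psi> (at v)) (at (T u))"
    using smooth_on_imp_differentiable[OF d.smooth v] T(3) by (simp add: has_derivative_frechet)
  from frechet_derivative_eqI[OF frechet_derivative_chain_on_open[OF T(1,2,4,5) this]]
  have D\<phi>: "frechet_derivative \<phi> (at u) x = frechet_derivative \<psi> (at v) (?J x)" for x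
    by simp
  have "((\<lambda>w. grass_chart (?G (\<phi> u)) (?G (\<psi> w))) has_derivative grass_differential (?G \<circ> \<psi>) v) (at (T u))"
    using d.gauss_differential(1)[OF v G(2)] by (simp add: uv T(3))
  from frechet_derivative_chain_on_open[OF T(1,2) _ T(5) this, of "\<lambda>w. grass_chart (?G (\<phi> u)) (?G (\<phi> w))"]
  have "((\<lambda>w. grass_chart (?G (\<phi> u)) (?G (\<phi> w))) has_derivative
      (\<lambda>x. grass_differential (?G \<circ> \<psi>) v (?J x))) (at u)"
    by (simp add: T(4))
  then have DG: "grass_differential (?G \<circ> \<phi>) u x = grass_differential (?G \<circ> \<psi>) v (?J x)" for x
    by (simp add: grass_differential_def frechet_derivative_eqI)
  obtain L :: "real^'m^'m" where L: "orthonormal_frame (L ** coordinate_frame \<phi> u)"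
    using ex_orthonormal_frame_of_plane[OF c.inj_frame[OF u]] by blast
  let ?X = "L ** coordinate_frame \<phi> u"
  have X: "?X $ a = frechet_derivative \<phi> (at u) (L $ a)" for a
    by (simp add: row_mult c.differential[OF u])
  have "tension (induced_metric \<phi>) \<phi> u = (\<Sum>a\<in>UNIV. grass_differential (?G \<circ> \<phi>) u (L $ a) *v (?X $ a))"
    by (rule c.tension_eq_frame_trace[OF u G(1) L X])
  also have "\<dots> = (\<Sum>a\<in>UNIV. grass_differential (?G \<circ> \<psi>) v (?J (L $ a)) *v (?X $ a))"
    by (simp add: DG)
  also have "\<dots> = tension (induced_metric \<psi>) \<psi> v"
    by (rule d.tension_eq_frame_trace[OF v G(2) L, symmetric]) (simp add: X D\<phi>)
  finally show ?thesis .
qed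

lemma squared_tension_function:
  assumes M: "oriented_submanifold M A"
  obtains t :: "real^'n::finite \<Rightarrow> real" where
    "\<And>U (\<phi> :: real^'m::finite \<Rightarrow> real^'n) u. (U, \<phi>) \<in> A \<Longrightarrow> u \<in> U \<Longrightarrow> t (\<phi> u) = (norm (tension (induced_metric \<phi>) \<phi> u))\<^sup>2"
proof -
  define good where "good q x \<longleftrightarrow> (\<exists>(U, \<phi>)\<in>A. \<exists>u\<in>U. \<phi> u = q \<and> x = (norm (tension (induced_metric \<phi>) \<phi> u))\<^sup>2)" for q x
  have "(THE x. good (\<phi> u) x) = (norm (tension (induced_metric \<phi>) \<phi> u))\<^sup>2" if "(U, \<phi>) \<in> A" "u \<in> U" for U \<phi> u
  proof (rule the_equality)
    show "good (\<phi> u) ((norm (tension (induced_metric \<phi>) \<phi> u))\<^sup>2)"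
      using that unfolding good_def by blast
    show "x = (norm (tension (induced_metric \<phi>) \<phi> u))\<^sup>2" if "good (\<phi> u) x" for x
      using that tension_well_defined[OF M _ \<open>(U, \<phi>) \<in> A\<close> _ \<open>u \<in> U\<close>] unfolding good_def by auto
  qed
  then show thesis by (rule that)
qed

section \<open>Tensors proportional to the metric\<close>

context immersed_chart
begin

lemma trace_metric:
  assumes u: "u \<in> U"
  shows "(\<Sum>i\<in>UNIV. \<Sum>j\<in>UNIV. ginv i j u * g u $ i $ j) = CARD('m)"
proof -
  have "(\<Sum>i\<in>UNIV. \<Sum>j\<in>UNIV. ginv i j u * g u $ i $ j) = (\<Sum>i\<in>UNIV. \<Sum>k\<in>UNIV. ginv i k u * (pd k \<phi> u \<bullet> pd i \<phi> u))"
    by (simp add: induced_metric_nth inner_commute)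
  then show ?thesis by (simp add: ginv_g[OF u])
qed

text \<open>Take the trace of the hypothesis.\<close>

lemma tension_of_umbilic:
  fixes s :: real
  assumes u: "u \<in> U" and umb: "\<And>i j. II i j u \<bullet> \<tau> u = s * g u $ i $ j"
  shows "(norm (\<tau> u))\<^sup>2 = CARD('m) * s"
proof -
  have "(norm (\<tau> u))\<^sup>2 = (\<Sum>i\<in>UNIV. \<Sum>j\<in>UNIV. ginv i j u * (s * g u $ i $ j))"
    by (simp add: power2_norm_eq_inner umb flip: trace_II)
  also have "\<dots> = s * (\<Sum>i\<in>UNIV. \<Sum>j\<in>UNIV. ginv i j u * g u $ i $ j)"
    by (simp add: sum_distrib_left mult.left_commute)
  finally show ?thesis by (simp add: trace_metric[OF u])
qed

lemma third_form_diag_nonneg: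
  assumes u: "u \<in> U" and G: "\<forall>w\<in>U. G (\<phi> w) = oplane (coordinate_frame \<phi> w)"
  shows "third_form u i i \<ge> 0"
  unfolding grass_metric_gauss_differential[OF assms, symmetric] grass_metric_def Let_def
  by (intro sum_nonneg) simp

end

text \<open>The factor \<open>s\<close> is a function on the ambient space, so that charts with overlapping images are
  forced to have the same factor.\<close>

definition proportional_to_metric ::
  "('m::finite, 'n::finite) param set \<Rightarrow> ((real^'m \<Rightarrow> real^'n) \<Rightarrow> real^'m \<Rightarrow> 'm \<Rightarrow> 'm \<Rightarrow> real)
    \<Rightarrow> (real^'n \<Rightarrow> real) \<Rightarrow> bool" where
  "proportional_to_metric A X s \<longleftrightarrow> (\<forall>U \<phi> u i j. (U, \<phi>) \<in> A \<longrightarrow> u \<in> U \<longrightarrow>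
     X \<phi> u i j = s (\<phi> u) * induced_metric \<phi> u $ i $ j)"

lemma all_charts_iff_proportional:
  assumes "\<And>U \<phi> u. (U, \<phi>) \<in> A \<Longrightarrow> u \<in> U \<Longrightarrow>
    R \<phi> u \<longleftrightarrow> (\<forall>i j. X \<phi> u i j = s (\<phi> u) * induced_metric \<phi> u $ i $ j)"
  shows "(\<forall>(U, \<phi>)\<in>A. \<forall>u\<in>U. R \<phi> u) \<longleftrightarrow> proportional_to_metric A X s"
proof -
  have "(\<forall>(U, \<phi>)\<in>A. \<forall>u\<in>U. R \<phi> u) \<longleftrightarrow> (\<forall>U \<phi>. (U, \<phi>) \<in> A \<longrightarrow> (\<forall>u\<in>U. R \<phi> u))"
    by auto
  then show ?thesis
    unfolding proportional_to_metric_def using assms by (simp add: Ball_def)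
qed

lemma proportional_to_metric_add:
  "proportional_to_metric A X s \<Longrightarrow> proportional_to_metric A Y r \<Longrightarrow>
    proportional_to_metric A (\<lambda>\<phi> u i j. X \<phi> u i j + Y \<phi> u i j) (\<lambda>q. s q + r q)"
  by (simp add: proportional_to_metric_def distrib_right)

lemma proportional_to_metric_diff:
  "proportional_to_metric A X s \<Longrightarrow> proportional_to_metric A Y r \<Longrightarrow>
    proportional_to_metric A (\<lambda>\<phi> u i j. X \<phi> u i j - Y \<phi> u i j) (\<lambda>q. s q - r q)"
  by (simp add: proportional_to_metric_def left_diff_distrib)

theorem proposition11:
  fixes M :: "(real^'n::finite) set" and A :: "('m::finite, 'n) param set"
  assumes "oriented_submanifold M A" and "CARD('m) > 2"
  shows "let \<iota> = (\<lambda>q :: real^'n. q);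
             a = (\<exists>f. smooth_function A f \<and> (\<forall>(U, \<phi>)\<in>A. \<forall>u\<in>U.
                    stress_energy2 (induced_metric \<phi>) (\<iota> \<circ> \<phi>) u = f (\<phi> u) *\<^sub>R induced_metric \<phi> u));
             b = einstein A;
             c = weakly_conformal M A (gauss_map A)
         in (a \<and> b \<longrightarrow> c) \<and> (a \<and> c \<longrightarrow> b) \<and> (b \<and> c \<longrightarrow> a)"
proof -
  note M = assms(1)
  \<comment> \<open>\<open>h\<close> and \<open>k\<close> are the tensors \<open>\<langle>B, \<tau>\<rangle>\<close> and \<open>T\<close> of the introduction.\<close>
  define h :: "(real^'m \<Rightarrow> real^'n) \<Rightarrow> real^'m \<Rightarrow> 'm \<Rightarrow> 'm \<Rightarrow> real" where
    "h \<phi> u i j = hessian_map (induced_metric \<phi>) \<phi> u i j \<bullet> tension (induced_metric \<phi>) \<phi> u" for \<phi> u i j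
  define k :: "(real^'m \<Rightarrow> real^'n) \<Rightarrow> real^'m \<Rightarrow> 'm \<Rightarrow> 'm \<Rightarrow> real" where
    "k = immersed_chart.third_form"
  note tensor_eq = proportional_to_metric_def
  have chart: "immersed_chart U \<phi>" if "(U, \<phi>) \<in> A" for U \<phi>
    by (rule oriented_submanifold_chart[OF M that])
  have G: "\<forall>w\<in>U. gauss_map A (\<phi> w) = oplane (coordinate_frame \<phi> w)" if "(U, \<phi>) \<in> A" for U \<phi>
    using gauss_map_eq[OF M that] by blast
  obtain t :: "real^'n \<Rightarrow> real" where t: "\<And>U \<phi> u. (U, \<phi>) \<in> A \<Longrightarrow> u \<in> U \<Longrightarrow>
      t (\<phi> u) = (norm (tension (induced_metric \<phi>) \<phi> u))\<^sup>2"
    using squared_tension_function[OF M] by blast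
  have ein: "einstein A \<longleftrightarrow> (\<exists>c. proportional_to_metric A (\<lambda>\<phi> u i j. h \<phi> u i j - k \<phi> u i j) c)"
  proof -
    have "ricci (induced_metric \<phi>) u = c (\<phi> u) *\<^sub>R induced_metric \<phi> u \<longleftrightarrow>
        (\<forall>i j. h \<phi> u i j - k \<phi> u i j = c (\<phi> u) * induced_metric \<phi> u $ i $ j)"
      if "(U, \<phi>) \<in> A" "u \<in> U" for U \<phi> u and c :: "real^'n \<Rightarrow> real"
      using immersed_chart.ricci_eq[OF chart that(2), OF that(1)]
      by (simp add: vec_eq_iff h_def k_def)
    then show ?thesis
      unfolding einstein_def by (intro arg_cong[of _ _ Ex] ext all_charts_iff_proportional)
  qed
  have conf: "weakly_conformal M A (gauss_map A) \<longleftrightarrow> (\<exists>\<mu>. (\<forall>q\<in>M. \<mu> q \<ge> 0) \<and> proportional_to_metric A k \<mu>)"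
  proof -
    have "grass_metric (gauss_map A (\<phi> u)) (grass_differential (gauss_map A \<circ> \<phi>) u (axis i 1))
        (grass_differential (gauss_map A \<circ> \<phi>) u (axis j 1)) = k \<phi> u i j"
      if "(U, \<phi>) \<in> A" "u \<in> U" for U \<phi> u i j
      unfolding k_def
      by (rule immersed_chart.grass_metric_gauss_differential[OF chart[OF that(1)] that(2) G[OF that(1)]])
    then have "(\<forall>(U, \<phi>)\<in>A. \<forall>u\<in>U. \<forall>i j.
          grass_metric (gauss_map A (\<phi> u)) (grass_differential (gauss_map A \<circ> \<phi>) u (axis i 1))
                                 (grass_differential (gauss_map A \<circ> \<phi>) u (axis j 1))
          = \<mu> (\<phi> u) * induced_metric \<phi> u $ i $ j) \<longleftrightarrow> proportional_to_metric A k \<mu>" for \<mu>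
      by (intro all_charts_iff_proportional) simp
    then show ?thesis unfolding weakly_conformal_def by (simp only:)
  qed
  \<comment> \<open>Solving \<open>2 \<langle>B, \<tau>\<rangle> - 1/2 |\<tau>|\<^sup>2 g = f g\<close> for \<open>\<langle>B, \<tau>\<rangle>\<close>.\<close>
  have stress: "(\<forall>(U, \<phi>)\<in>A. \<forall>u\<in>U. stress_energy2 (induced_metric \<phi>) \<phi> u = f (\<phi> u) *\<^sub>R induced_metric \<phi> u)
      \<longleftrightarrow> proportional_to_metric A h (\<lambda>q. f q / 2 + t q / 4)" for f
  proof -
    have "stress_energy2 (induced_metric \<phi>) \<phi> u = f (\<phi> u) *\<^sub>R induced_metric \<phi> u \<longleftrightarrow>
        (\<forall>i j. h \<phi> u i j = (f (\<phi> u) / 2 + t (\<phi> u) / 4) * induced_metric \<phi> u $ i $ j)"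
      if "(U, \<phi>) \<in> A" "u \<in> U" for U \<phi> u
    proof -
      have "stress_energy2 (induced_metric \<phi>) \<phi> u $ i $ j = f (\<phi> u) * induced_metric \<phi> u $ i $ j \<longleftrightarrow>
        h \<phi> u i j = (f (\<phi> u) / 2 + t (\<phi> u) / 4) * induced_metric \<phi> u $ i $ j" for i j
        unfolding immersed_chart.stress_energy2_eq[OF chart[OF that(1)] that(2)] t[OF that] h_def
        by (auto simp: algebra_simps)
      then show ?thesis by (simp add: vec_eq_iff)
    qed
    then show ?thesis by (intro all_charts_iff_proportional)
  qed
  have k_nonneg: "s q \<ge> 0" if k: "proportional_to_metric A k s" and "q \<in> M" for s q
  proof -
    obtain U \<phi> u where u: "(U, \<phi>) \<in> A" "u \<in> U" "q = \<phi> u"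
      using \<open>q \<in> M\<close> oriented_submanifold_mem[OF M] by auto
    interpret immersed_chart U \<phi> by (rule chart[OF u(1)])
    obtain i :: 'm where True by simp
    have "third_form u i i = s q * g u $ i $ i"
      using k u unfolding tensor_eq k_def by blast
    then show ?thesis
      using third_form_diag_nonneg[OF u(2) G[OF u(1)], of i] metric_diag_pos[OF u(2), of i]
      by (simp add: zero_le_mult_iff)
  qed
  have ab: "weakly_conformal M A (gauss_map A)" if "proportional_to_metric A h s" "einstein A" for s
  proof -
    from that(2)[unfolded ein]
    obtain c where "proportional_to_metric A (\<lambda>\<phi> u i j. h \<phi> u i j - k \<phi> u i j) c" ..
    from proportional_to_metric_diff[OF that(1) this]
    have k: "proportional_to_metric A k (\<lambda>q. s q - c q)" by simp
    show ?thesis unfolding conf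
      by (intro exI[of _ "\<lambda>q. s q - c q"] conjI ballI k k_nonneg[OF k])
  qed
  have ac: "einstein A" if "proportional_to_metric A h s" "weakly_conformal M A (gauss_map A)" for s
  proof -
    from that(2)[unfolded conf] obtain \<mu> where "proportional_to_metric A k \<mu>" by (elim exE conjE)
    from proportional_to_metric_diff[OF that(1) this] show ?thesis
      unfolding ein by (rule exI[of _ "\<lambda>q. s q - \<mu> q"])
  qed
  have bc: "\<exists>f. smooth_function A f \<and> proportional_to_metric A h (\<lambda>q. f q / 2 + t q / 4)"
    if "einstein A" "weakly_conformal M A (gauss_map A)"
  proof -
    from that(2)[unfolded conf] obtain \<mu> where \<mu>: "proportional_to_metric A k \<mu>" by (elim exE conjE)
    from that(1)[unfolded ein]
    obtain c where "proportional_to_metric A (\<lambda>\<phi> u i j. h \<phi> u i j - k \<phi> u i j) c" ..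
    from proportional_to_metric_add[OF \<mu> this]
    have h: "proportional_to_metric A h (\<lambda>q. \<mu> q + c q)" by simp
    \<comment> \<open>The factor \<open>s = |\<tau>|\<^sup>2 / m\<close> must equal \<open>f / 2 + |\<tau>|\<^sup>2 / 4\<close>.\<close>
    define f where "f = (\<lambda>q. (2 / CARD('m) - 1 / 2) * t q)"
    have "smooth_function A f"
      unfolding smooth_function_def
    proof (intro ballI, clarify)
      fix U \<phi> assume c: "(U, \<phi>) \<in> A"
      interpret immersed_chart U \<phi> by (rule chart[OF c])
      have "smooth_on U (\<lambda>u. (2 / CARD('m) - 1 / 2) * (\<tau> u \<bullet> \<tau> u))"
        by (intro smooth_on_mult smooth_on_const smooth_on_inner smooth_tension open_domain)
      then show "smooth_on U (f \<circ> \<phi>)"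
        by (rule smooth_on_cong[OF open_domain]) (simp add: f_def t[OF c] power2_norm_eq_inner)
    qed
    moreover have "proportional_to_metric A h (\<lambda>q. f q / 2 + t q / 4)"
      unfolding tensor_eq
    proof (intro allI impI)
      fix U \<phi> u i j assume c: "(U, \<phi>) \<in> A" and u: "u \<in> U"
      interpret immersed_chart U \<phi> by (rule chart[OF c])
      define s where "s = \<mu> (\<phi> u) + c (\<phi> u)"
      have umb: "h \<phi> u i j = s * g u $ i $ j" for i j
        using h[unfolded tensor_eq] c u unfolding s_def by blast
      have n: "t (\<phi> u) = CARD('m) * s"
        unfolding t[OF c u] by (rule tension_of_umbilic[OF u umb[unfolded h_def]])
      have "f (\<phi> u) / 2 + t (\<phi> u) / 4 = s"
        unfolding f_def n by (simp add: field_simps)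
      then show "h \<phi> u i j = (f (\<phi> u) / 2 + t (\<phi> u) / 4) * g u $ i $ j"
        by (simp only: umb)
    qed
    ultimately show ?thesis by blast
  qed
  have id: "(\<lambda>q :: real^'n. q) \<circ> \<phi> = \<phi>" for \<phi> :: "real^'m \<Rightarrow> real^'n"
    by (simp add: fun_eq_iff)
  show ?thesis
    unfolding Let_def id stress using ab ac bc by (intro conjI impI) (elim exE conjE, blast)+
qed

end
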